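(* For all $x,y\in\mathbb{R}^D\times\mathbb{R}^D$, with $\Delta x=x-z$ and $\Delta y=y-z$, the covariance function $k_{\tilde f}(x,y)=\operatorname{Cov}(\tilde f(x),\tilde f(y))$ of the quadratic Taylor approximation at $z=(z^*,z^* )$ is $$k_{\tilde f}(x,y)=-4h'(0)\Big(\langle\Delta x,\Delta y\rangle_2-\langle\Delta x,(\Delta y)^{flip}\rangle_2\Big)+4h''(0)\Big(\langle\Delta x,\Delta y\rangle_2^2-\langle\Delta x,(\Delta y)^{flip}\rangle_2^2\Big).$$
   Context: Let $D\ge 1$ and write points of $\mathbb{R}^D\times\mathbb{R}^D$ as $x=(x^{(1)},x^{(2)})$, with $x^{flip}=(x^{(2)},x^{(1)})$; $\langle\cdot,\cdot\rangle_2$ is the Euclidean inner product on $\mathbb{R}^{2D}$. A real-valued random field is Gaussian if every finite linear combination of its values is a (possibly degenerate) Gaussian random variable. Let $u$ be a mean-zero isotropic Gaussian field on $\mathbb{R}^D\times\mathbb{R}^D$ with covariance function $k_u(x,y)=h(\|x-y\|_2^2)$, where $h:[0,\infty)\to\mathbb{R}$. The field $f(x)=u(x)-u(x^{flip})$ is called a block isotropic Gaussian field with base field $u$; its covariance function is denoted $k_f$. Standing smoothness assumption: $k_u$ (hence $k_f$) is four times continuously differentiable, and $h$ is twice continuously differentiable on $[0,\infty)$. Derivatives of $f$ are taken in the mean-square ($L^2(\Omega)$) sense. Fix $z^*\in\mathbb{R}^D$ and $z=(z^*,z^* )$. Define $$g_i=\partial_{x^{(1)}_i}f(x)\big|_{x=z},\quad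 H^{(1,1)}_{i,j}=\partial_{x^{(1)}_i}\partial_{x^{(1)}_j}f(x)\big|_{x=z},\quad H^{(1,2)}_{i,j}=\partial_{x^{(1)}_i}\partial_{x^{(2)}_j}f(x)\big|_{x=z}.$$ The second-order (skew-symmetric) Taylor approximation of $f$ at $z$ is $$\tilde f(x)=g^{\mathsf T}(v-w)+\tfrac12\big(v^{\mathsf T}H^{(1,1)}v-w^{\mathsf T}H^{(1,1)}w\big)+v^{\mathsf T}H^{(1,2)}w,\qquad v=x^{(1)}-z^*,\ w=x^{(2)}-z^*.$$ *)

theory Defs
  imports "HOL-Probability.Probability"
begin

definition gaussian_rv :: "'w measure \<Rightarrow> ('w \<Rightarrow> real) \<Rightarrow> bool" where
  "gaussian_rv M X \<longleftrightarrow> X \<in> borel_measurable M \<and>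
     ((\<exists>\<mu>. AE \<omega> in M. X \<omega> = \<mu>) \<or>
      (\<exists>\<mu> \<sigma>. \<sigma> > 0 \<and> distributed M lborel X (normal_density \<mu> \<sigma>)))"

definition gaussian_field :: "'w measure \<Rightarrow> ('a \<Rightarrow> 'w \<Rightarrow> real) \<Rightarrow> bool" where
  "gaussian_field M F \<longleftrightarrow>
     (\<forall>S c. finite S \<longrightarrow> gaussian_rv M (\<lambda>\<omega>. \<Sum>x\<in>S. c x * F x \<omega>))"

definition covariance :: "'w measure \<Rightarrow> ('w \<Rightarrow> real) \<Rightarrow> ('w \<Rightarrow> real) \<Rightarrow> real" where
  "covariance M X Y =
     integral\<^sup>L M (\<lambda>\<omega>. (X \<omega> - integral\<^sup>L M X) * (Y \<omega> - integral\<^sup>L M Y))"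

definition covariance_fun ::
    "'w measure \<Rightarrow> ('a \<Rightarrow> 'w \<Rightarrow> real) \<Rightarrow> 'a \<Rightarrow> 'a \<Rightarrow> real" where
  "covariance_fun M F x y = covariance M (F x) (F y)"

primrec times_cont_differentiable :: "nat \<Rightarrow> ('a::euclidean_space \<Rightarrow> real) \<Rightarrow> bool" where
  "times_cont_differentiable 0 f \<longleftrightarrow> continuous_on UNIV f"
| "times_cont_differentiable (Suc n) f \<longleftrightarrow>
     (\<forall>x. f differentiable (at x)) \<and>
     (\<forall>e\<in>Basis. times_cont_differentiable n (\<lambda>x. frechet_derivative f (at x) e))"

definition square_integrable :: "'w measure \<Rightarrow> ('w \<Rightarrow> real) \<Rightarrow> bool" where
  "square_integrable M X \<longleftrightarrow> X \<in> borel_measurable M \<and> integrable M (\<lambda>\<omega>. (X \<omega>)\<^sup>2)"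

(* The square-integrability requirements are needed because the Bochner integral of a
   non-integrable function is 0. *)
definition has_ms_derivative ::
    "'w measure \<Rightarrow> ('a::real_normed_vector \<Rightarrow> 'w \<Rightarrow> real) \<Rightarrow> 'a \<Rightarrow> 'a \<Rightarrow> ('w \<Rightarrow> real) \<Rightarrow> bool" where
  "has_ms_derivative M F e x X \<longleftrightarrow>
     (\<forall>y. square_integrable M (F y)) \<and> square_integrable M X \<and>
     ((\<lambda>t::real. integral\<^sup>L M (\<lambda>\<omega>. ((F (x + t *\<^sub>R e) \<omega> - F x \<omega>) / t - X \<omega>)\<^sup>2))
        \<longlongrightarrow> 0) (at 0)"

(* Mean-square derivatives are unique only up to null sets; this selects one version at each
   point. If no mean-square derivative exists, the value is unspecified. *)
definition ms_deriv ::
    "'w measure \<Rightarrow> 'a \<Rightarrow> ('a::real_normed_vector \<Rightarrow> 'w \<Rightarrow> real) \<Rightarrow> 'a \<Rightarrow> 'w \<Rightarrow> real" where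
  "ms_deriv M e F x = (SOME X. has_ms_derivative M F e x X)"

type_synonym 'd pt = "(real^'d) \<times> (real^'d)"

abbreviation dir1 :: "'d::finite \<Rightarrow> 'd pt" where
  "dir1 i \<equiv> (axis i 1, 0)"

abbreviation dir2 :: "'d::finite \<Rightarrow> 'd pt" where
  "dir2 i \<equiv> (0, axis i 1)"

abbreviation flip :: "'a \<times> 'a \<Rightarrow> 'a \<times> 'a" where
  "flip \<equiv> prod.swap"

definition block_field :: "('d::finite pt \<Rightarrow> 'w \<Rightarrow> real) \<Rightarrow> 'd pt \<Rightarrow> 'w \<Rightarrow> real" where
  "block_field u x \<omega> = u x \<omega> - u (flip x) \<omega>"

definition taylor_g ::
    "'w measure \<Rightarrow> ('d::finite pt \<Rightarrow> 'w \<Rightarrow> real) \<Rightarrow> 'd pt \<Rightarrow> 'w \<Rightarrow> real^'d" where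
  "taylor_g M f z \<omega> = (\<chi> i. ms_deriv M (dir1 i) f z \<omega>)"

definition taylor_H11 ::
    "'w measure \<Rightarrow> ('d::finite pt \<Rightarrow> 'w \<Rightarrow> real) \<Rightarrow> 'd pt \<Rightarrow> 'w \<Rightarrow> real^'d^'d" where
  "taylor_H11 M f z \<omega> = (\<chi> i j. ms_deriv M (dir1 i) (ms_deriv M (dir1 j) f) z \<omega>)"

definition taylor_H12 ::
    "'w measure \<Rightarrow> ('d::finite pt \<Rightarrow> 'w \<Rightarrow> real) \<Rightarrow> 'd pt \<Rightarrow> 'w \<Rightarrow> real^'d^'d" where
  "taylor_H12 M f z \<omega> = (\<chi> i j. ms_deriv M (dir1 i) (ms_deriv M (dir2 j) f) z \<omega>)"

definition skew_taylor2 ::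
    "'w measure \<Rightarrow> ('d::finite pt \<Rightarrow> 'w \<Rightarrow> real) \<Rightarrow> real^'d \<Rightarrow> 'd pt \<Rightarrow> 'w \<Rightarrow> real" where
  "skew_taylor2 M f zs x \<omega> =
     (let z = (zs, zs); v = fst x - zs; w = snd x - zs;
          g = taylor_g M f z \<omega>; H11 = taylor_H11 M f z \<omega>; H12 = taylor_H12 M f z \<omega>
      in g \<bullet> (v - w) + (1/2) * (v \<bullet> (H11 *v v) - w \<bullet> (H11 *v w)) + v \<bullet> (H12 *v w))"

end

theory Submission
  imports Defs
begin

text \<open>
  All statements take place in the Hilbert space \<open>L\<^sup>2(M)\<close>, to which a Gaussian field belongs because
  normal variables have second moments, and the Taylor polynomial is a finite
  combination of mean-square derivatives of the base field u at the single point z = flip z. So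
  the covariance follows once the derivatives are known to exist and their inner products are
  known; the rest is bilinear algebra.

  Existence. Restricted to a line, u is a stationary process G with covariance
  \<open>\<kappa>(s - t)\<close>, where \<open>\<kappa>(r) = h(c r\<^sup>2)\<close>. Such a process is mean-square differentiable as soon as
  \<open>\<kappa>\<close> has a second-order expansion \<open>\<kappa>(r) = \<kappa>(0) + l r\<^sup>2 + o(r\<^sup>2)\<close> at the origin: positive
  definiteness makes the remainder m a nonnegative function with nonnegative second differences,
  and this convexity spreads the bound \<open>o(r\<^sup>2)\<close> from the origin to the mixed second differences
  of \<open>\<kappa>\<close>, so that the difference quotients are Cauchy (\<open>stationary_L2_differentiable\<close>). By
  completeness of \<open>L\<^sup>2\<close> they converge. The first derivative of u along a is again a
  stationary field, with an explicit covariance in terms of h' and h'', and it has an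
  expansion of the same kind along every line; the same lemma therefore gives the second
  derivatives.

  Inner products. Since inner products pass to mean-square limits, differentiating
  \<open>h(\<parallel>p - q\<parallel>\<^sup>2)\<close> once in p and once in q gives the covariance of first derivatives.
  For second derivatives only the expansion of that covariance at the origin matters: the
  covariance of two difference quotients with the same step combines its values at three
  displacements and at the origin, and the limit is the polarisation of its quadratic term,
  \<open>4 h''(0) (\<langle>a,b\<rangle>\<langle>c,d\<rangle> + \<langle>a,c\<rangle>\<langle>b,d\<rangle> + \<langle>a,d\<rangle>\<langle>b,c\<rangle>)\<close>. The same expansion has no linear term, so first and
  second derivatives at one point are uncorrelated.

  Block fields. A derivative of the block field f at z along a is the derivative of u along a
  minus the one along flip a. In the covariance of second derivatives of f the term
  \<open>\<langle>a,b\<rangle>\<langle>c,d\<rangle>\<close> is flip invariant and cancels, which is why the coefficient of \<open>h''(0)\<close> contains only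
  the squares of \<open>\<langle>\<Delta>x,\<Delta>y\<rangle>\<close> and \<open>\<langle>\<Delta>x,flip \<Delta>y\<rangle>\<close> and no norms of \<open>\<Delta>x\<close> and \<open>\<Delta>y\<close>.
\<close>

section \<open>The inner product of square-integrable random variables\<close>

definition L2_inner :: "'w measure \<Rightarrow> ('w \<Rightarrow> real) \<Rightarrow> ('w \<Rightarrow> real) \<Rightarrow> real" where
  "L2_inner M X Y = integral\<^sup>L M (\<lambda>\<omega>. X \<omega> * Y \<omega>)"

definition L2_tendsto ::
    "'w measure \<Rightarrow> ('b \<Rightarrow> 'w \<Rightarrow> real) \<Rightarrow> ('w \<Rightarrow> real) \<Rightarrow> 'b filter \<Rightarrow> bool" where
  "L2_tendsto M D X F \<longleftrightarrow> ((\<lambda>s. integral\<^sup>L M (\<lambda>\<omega>. (D s \<omega> - X \<omega>)\<^sup>2)) \<longlongrightarrow> 0) F"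

lemma integrable_mult_square_integrable:
  assumes "square_integrable M X" "square_integrable M Y"
  shows "integrable M (\<lambda>\<omega>. X \<omega> * Y \<omega>)"
proof (rule Bochner_Integration.integrable_bound)
  have [measurable]: "X \<in> borel_measurable M" "Y \<in> borel_measurable M"
    using assms by (auto simp: square_integrable_def)
  show "(\<lambda>\<omega>. X \<omega> * Y \<omega>) \<in> borel_measurable M" by measurable
  show "integrable M (\<lambda>\<omega>. (X \<omega>)\<^sup>2 + (Y \<omega>)\<^sup>2)"
    using assms by (auto simp: square_integrable_def)
  have "\<bar>x * y\<bar> \<le> x\<^sup>2 + y\<^sup>2" for x y :: real
  proof -
    have "2 * \<bar>x\<bar> * \<bar>y\<bar> \<le> x\<^sup>2 + y\<^sup>2" using sum_squares_bound[of "\<bar>x\<bar>" "\<bar>y\<bar>"] by simp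
    moreover have "0 \<le> \<bar>x\<bar> * \<bar>y\<bar>" by simp
    ultimately show ?thesis unfolding abs_mult by linarith
  qed
  then show "AE \<omega> in M. norm (X \<omega> * Y \<omega>) \<le> norm ((X \<omega>)\<^sup>2 + (Y \<omega>)\<^sup>2)"
    by (intro AE_I2) (auto simp: order_trans)
qed

lemma square_integrable_add [intro]:
  assumes "square_integrable M X" "square_integrable M Y"
  shows "square_integrable M (\<lambda>\<omega>. X \<omega> + Y \<omega>)"
  using assms integrable_mult_square_integrable[OF assms]
  unfolding square_integrable_def power2_sum by (auto simp: mult.assoc)

lemma square_integrable_cmult [intro]:
  "square_integrable M X \<Longrightarrow> square_integrable M (\<lambda>\<omega>. c * X \<omega>)"
  unfolding square_integrable_def by (auto simp: power_mult_distrib)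

lemma square_integrable_diff [intro]:
  assumes "square_integrable M X" "square_integrable M Y"
  shows "square_integrable M (\<lambda>\<omega>. X \<omega> - Y \<omega>)"
  using square_integrable_add[OF assms(1) square_integrable_cmult[OF assms(2), of "-1"]] by simp

lemma square_integrable_divide [intro]:
  "square_integrable M X \<Longrightarrow> square_integrable M (\<lambda>\<omega>. X \<omega> / c)"
  using square_integrable_cmult[of M X "inverse c"] by (simp add: field_simps)

lemma square_integrable_zero [intro]: "square_integrable M (\<lambda>\<omega>. 0)"
  by (simp add: square_integrable_def)

lemma square_integrable_sum [intro]:
  assumes "\<And>i. i \<in> I \<Longrightarrow> square_integrable M (X i)"
  shows "square_integrable M (\<lambda>\<omega>. \<Sum>i\<in>I. X i \<omega>)"
  using assms by (induction I rule: infinite_finite_induct) auto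

lemma (in prob_space) square_integrable_const [intro]: "square_integrable M (\<lambda>\<omega>. c)"
  by (simp add: square_integrable_def)

lemma L2_inner_commute: "L2_inner M X Y = L2_inner M Y X"
  by (simp add: L2_inner_def mult.commute)

lemma L2_inner_add_left:
  assumes "square_integrable M X" "square_integrable M X'" "square_integrable M Y"
  shows "L2_inner M (\<lambda>\<omega>. X \<omega> + X' \<omega>) Y = L2_inner M X Y + L2_inner M X' Y"
  using assms by (simp add: L2_inner_def distrib_right integrable_mult_square_integrable)

lemma L2_inner_diff_left:
  assumes "square_integrable M X" "square_integrable M X'" "square_integrable M Y"
  shows "L2_inner M (\<lambda>\<omega>. X \<omega> - X' \<omega>) Y = L2_inner M X Y - L2_inner M X' Y"
  using assms by (simp add: L2_inner_def left_diff_distrib integrable_mult_square_integrable)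

lemma L2_inner_cmult_left: "L2_inner M (\<lambda>\<omega>. c * X \<omega>) Y = c * L2_inner M X Y"
  by (simp add: L2_inner_def mult.assoc)

lemma L2_inner_divide_left: "L2_inner M (\<lambda>\<omega>. X \<omega> / c) Y = L2_inner M X Y / c"
  using L2_inner_cmult_left[of M "inverse c" X Y] by (simp add: field_simps)

lemma L2_inner_sum_left:
  assumes "\<And>i. i \<in> I \<Longrightarrow> square_integrable M (X i)" "square_integrable M Y"
  shows "L2_inner M (\<lambda>\<omega>. \<Sum>i\<in>I. X i \<omega>) Y = (\<Sum>i\<in>I. L2_inner M (X i) Y)"
  unfolding L2_inner_def sum_distrib_right
  using assms by (intro Bochner_Integration.integral_sum integrable_mult_square_integrable) auto

lemma L2_inner_add_right:
  assumes "square_integrable M X" "square_integrable M X'" "square_integrable M Y"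
  shows "L2_inner M Y (\<lambda>\<omega>. X \<omega> + X' \<omega>) = L2_inner M Y X + L2_inner M Y X'"
  using L2_inner_add_left[OF assms] by (simp add: L2_inner_commute)

lemma L2_inner_diff_right:
  assumes "square_integrable M X" "square_integrable M X'" "square_integrable M Y"
  shows "L2_inner M Y (\<lambda>\<omega>. X \<omega> - X' \<omega>) = L2_inner M Y X - L2_inner M Y X'"
  using L2_inner_diff_left[OF assms] by (simp add: L2_inner_commute)

lemma L2_inner_divide_right: "L2_inner M Y (\<lambda>\<omega>. X \<omega> / c) = L2_inner M Y X / c"
  using L2_inner_divide_left[of M X c Y] by (simp add: L2_inner_commute)

lemma L2_inner_self_nonneg: "0 \<le> L2_inner M X X"
  by (simp add: L2_inner_def)

lemma L2_inner_cong_AE: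
  assumes "AE \<omega> in M. X \<omega> = X' \<omega>" "AE \<omega> in M. Y \<omega> = Y' \<omega>"
    and "X \<in> borel_measurable M" "X' \<in> borel_measurable M"
        "Y \<in> borel_measurable M" "Y' \<in> borel_measurable M"
  shows "L2_inner M X Y = L2_inner M X' Y'"
  unfolding L2_inner_def
proof (rule integral_cong_AE)
  show "AE \<omega> in M. X \<omega> * Y \<omega> = X' \<omega> * Y' \<omega>" using assms(1,2) by eventually_elim simp
qed (use assms(3-) in measurable)

lemma L2_inner_diff_self:
  assumes X: "square_integrable M X" and Y: "square_integrable M Y"
  shows "integral\<^sup>L M (\<lambda>\<omega>. (X \<omega> - Y \<omega>)\<^sup>2) = L2_inner M X X + L2_inner M Y Y - 2 * L2_inner M X Y"
proof -
  have "integral\<^sup>L M (\<lambda>\<omega>. (X \<omega> - Y \<omega>)\<^sup>2) = L2_inner M (\<lambda>\<omega>. X \<omega> - Y \<omega>) (\<lambda>\<omega>. X \<omega> - Y \<omega>)"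
    by (simp add: L2_inner_def power2_eq_square)
  also have "\<dots> = L2_inner M X X + L2_inner M Y Y - 2 * L2_inner M X Y"
    using X Y by (simp add: L2_inner_diff_left L2_inner_diff_right square_integrable_diff L2_inner_commute[of M Y X])
  finally show ?thesis .
qed

lemma L2_Cauchy_Schwarz:
  assumes X: "square_integrable M X" and Y: "square_integrable M Y"
  shows "(L2_inner M X Y)\<^sup>2 \<le> L2_inner M X X * L2_inner M Y Y"
proof -
  define a b c where "a = L2_inner M X X" and "b = L2_inner M X Y" and "c = L2_inner M Y Y"
  have ac: "0 \<le> a" "0 \<le> c" by (auto simp: a_def c_def L2_inner_self_nonneg)
  have quad: "0 \<le> a + t\<^sup>2 * c - 2 * t * b" for t
  proof -
    have tY: "square_integrable M (\<lambda>\<omega>. t * Y \<omega>)" using Y by auto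
    have "0 \<le> integral\<^sup>L M (\<lambda>\<omega>. (X \<omega> - t * Y \<omega>)\<^sup>2)" by simp
    also have "\<dots> = a + t\<^sup>2 * c - 2 * t * b"
      unfolding L2_inner_diff_self[OF X tY]
      by (simp add: L2_inner_cmult_left L2_inner_commute[of M _ "\<lambda>\<omega>. t * Y \<omega>"] a_def b_def c_def
          L2_inner_commute[of M Y X] power2_eq_square)
    finally show ?thesis .
  qed
  show ?thesis
  proof (cases "c = 0")
    case True
    have "b = 0"
    proof (rule ccontr)
      assume "b \<noteq> 0"
      then show False using quad[of "(a + 1) / (2 * b)"] True by (simp add: field_simps)
    qed
    then show ?thesis using ac by (simp add: b_def[symmetric] a_def[symmetric] c_def[symmetric])
  next
    case False
    then have "c > 0" using ac by simp
    then show ?thesis using quad[of "b / c"]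
      by (simp add: a_def[symmetric] b_def[symmetric] c_def[symmetric] field_simps power2_eq_square)
  qed
qed

lemma L2_inner_abs_le:
  assumes X: "square_integrable M X" and Y: "square_integrable M Y"
  shows "\<bar>L2_inner M X Y\<bar> \<le> sqrt (L2_inner M X X) * sqrt (L2_inner M Y Y)"
  using real_sqrt_le_mono[OF L2_Cauchy_Schwarz[OF X Y]] by (simp add: real_sqrt_mult)

lemma L2_tendsto_inner_left:
  assumes lim: "L2_tendsto M D X F"
    and D: "eventually (\<lambda>s. square_integrable M (D s)) F"
    and X: "square_integrable M X" and Y: "square_integrable M Y"
  shows "((\<lambda>s. L2_inner M (D s) Y) \<longlongrightarrow> L2_inner M X Y) F"
proof (rule Lim_transform[where g = "\<lambda>_. L2_inner M X Y"])
  show "((\<lambda>_. L2_inner M X Y) \<longlongrightarrow> L2_inner M X Y) F" by simp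
  have 0: "((\<lambda>s. sqrt (integral\<^sup>L M (\<lambda>\<omega>. (D s \<omega> - X \<omega>)\<^sup>2)) * sqrt (L2_inner M Y Y)) \<longlongrightarrow> 0) F"
    using tendsto_mult_left_zero[OF tendsto_real_sqrt[OF lim[unfolded L2_tendsto_def], simplified]] by simp
  show "((\<lambda>s. L2_inner M (D s) Y - L2_inner M X Y) \<longlongrightarrow> 0) F"
  proof (rule Lim_null_comparison[OF _ 0])
    show "\<forall>\<^sub>F s in F. norm (L2_inner M (D s) Y - L2_inner M X Y)
        \<le> sqrt (integral\<^sup>L M (\<lambda>\<omega>. (D s \<omega> - X \<omega>)\<^sup>2)) * sqrt (L2_inner M Y Y)"
      using D
    proof eventually_elim
      case (elim s)
      have "\<bar>L2_inner M (D s) Y - L2_inner M X Y\<bar> = \<bar>L2_inner M (\<lambda>\<omega>. D s \<omega> - X \<omega>) Y\<bar>"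
        using elim X Y by (simp add: L2_inner_diff_left)
      also have "\<dots> \<le> sqrt (L2_inner M (\<lambda>\<omega>. D s \<omega> - X \<omega>) (\<lambda>\<omega>. D s \<omega> - X \<omega>)) * sqrt (L2_inner M Y Y)"
        using elim X Y by (intro L2_inner_abs_le) auto
      finally show ?case by (simp add: L2_inner_def power2_eq_square)
    qed
  qed
qed

lemma L2_tendsto_inner:
  assumes A: "L2_tendsto M A X F" "\<And>s. square_integrable M (A s)" "square_integrable M X"
    and B: "L2_tendsto M B Y F" "\<And>s. square_integrable M (B s)" "square_integrable M Y"
  shows "((\<lambda>s. L2_inner M (A s) (B s)) \<longlongrightarrow> L2_inner M X Y) F"
proof -
  let ?e = "\<lambda>s. sqrt (integral\<^sup>L M (\<lambda>\<omega>. (A s \<omega> - X \<omega>)\<^sup>2)) * sqrt (integral\<^sup>L M (\<lambda>\<omega>. (B s \<omega> - Y \<omega>)\<^sup>2))"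
  have "((\<lambda>s. L2_inner M (\<lambda>\<omega>. A s \<omega> - X \<omega>) (\<lambda>\<omega>. B s \<omega> - Y \<omega>)) \<longlongrightarrow> 0) F"
  proof (rule Lim_null_comparison)
    show "(?e \<longlongrightarrow> 0) F"
      using tendsto_mult[OF tendsto_real_sqrt[OF A(1)[unfolded L2_tendsto_def]]
          tendsto_real_sqrt[OF B(1)[unfolded L2_tendsto_def]]] by simp
    have "\<bar>L2_inner M (\<lambda>\<omega>. A s \<omega> - X \<omega>) (\<lambda>\<omega>. B s \<omega> - Y \<omega>)\<bar> \<le> ?e s" for s
      using L2_inner_abs_le[of M "\<lambda>\<omega>. A s \<omega> - X \<omega>" "\<lambda>\<omega>. B s \<omega> - Y \<omega>"] A B
      by (simp add: L2_inner_def power2_eq_square square_integrable_diff)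
    then show "\<forall>\<^sub>F s in F. norm (L2_inner M (\<lambda>\<omega>. A s \<omega> - X \<omega>) (\<lambda>\<omega>. B s \<omega> - Y \<omega>)) \<le> ?e s"
      by (intro always_eventually) auto
  qed
  moreover have "((\<lambda>s. L2_inner M (A s) Y) \<longlongrightarrow> L2_inner M X Y) F"
    using L2_tendsto_inner_left[OF A(1) _ A(3) B(3)] A by auto
  moreover have "((\<lambda>s. L2_inner M X (B s)) \<longlongrightarrow> L2_inner M X Y) F"
    using L2_tendsto_inner_left[OF B(1) _ B(3) A(3)] B by (auto simp: L2_inner_commute[of M X])
  ultimately have "((\<lambda>s. L2_inner M (\<lambda>\<omega>. A s \<omega> - X \<omega>) (\<lambda>\<omega>. B s \<omega> - Y \<omega>) + L2_inner M (A s) Y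
      + L2_inner M X (B s) - L2_inner M X Y) \<longlongrightarrow> 0 + L2_inner M X Y + L2_inner M X Y - L2_inner M X Y) F"
    by (intro tendsto_intros)
  then show ?thesis
    using A B by (simp add: L2_inner_diff_left L2_inner_diff_right square_integrable_diff)
qed

lemma L2_limit_unique_AE:
  assumes F: "F \<noteq> bot" and "L2_tendsto M D X F" "L2_tendsto M D Y F" "\<And>s. square_integrable M (D s)"
    and X: "square_integrable M X" and Y: "square_integrable M Y"
  shows "AE \<omega> in M. X \<omega> = Y \<omega>"
proof -
  have eq: "L2_inner M X Z = L2_inner M Y Z" if "square_integrable M Z" for Z
    using assms that by (intro tendsto_unique[OF F L2_tendsto_inner_left L2_tendsto_inner_left]) auto
  have "integral\<^sup>L M (\<lambda>\<omega>. (X \<omega> - Y \<omega>)\<^sup>2) = 0"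
    unfolding L2_inner_diff_self[OF X Y] using eq[OF X] eq[OF Y] by (simp add: L2_inner_commute)
  moreover have "integrable M (\<lambda>\<omega>. (X \<omega> - Y \<omega>)\<^sup>2)"
    using square_integrable_diff[OF X Y] by (simp add: square_integrable_def)
  ultimately have "AE \<omega> in M. (X \<omega> - Y \<omega>)\<^sup>2 = 0"
    by (subst (asm) integral_nonneg_eq_0_iff_AE) auto
  then show ?thesis by eventually_elim simp
qed

lemma L2_norm_diff_le:
  assumes X: "square_integrable M X" and Y: "square_integrable M Y"
  shows "integral\<^sup>L M (\<lambda>\<omega>. (X \<omega> - Y \<omega>)\<^sup>2)
    \<le> 2 * integral\<^sup>L M (\<lambda>\<omega>. (X \<omega>)\<^sup>2) + 2 * integral\<^sup>L M (\<lambda>\<omega>. (Y \<omega>)\<^sup>2)"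
proof -
  have "0 \<le> L2_inner M (\<lambda>\<omega>. X \<omega> + Y \<omega>) (\<lambda>\<omega>. X \<omega> + Y \<omega>)"
    by (rule L2_inner_self_nonneg)
  also have "\<dots> = L2_inner M X X + L2_inner M Y Y + 2 * L2_inner M X Y"
    using X Y by (simp add: L2_inner_add_left L2_inner_add_right square_integrable_add L2_inner_commute[of M Y X])
  finally have "L2_inner M X X + L2_inner M Y Y - 2 * L2_inner M X Y
      \<le> 2 * L2_inner M X X + 2 * L2_inner M Y Y"
    by simp
  then show ?thesis
    unfolding L2_inner_diff_self[OF X Y] by (simp add: L2_inner_def power2_eq_square)
qed

lemma L2_tendsto_diff:
  assumes A: "L2_tendsto M A X F" "\<And>s. square_integrable M (A s)" "square_integrable M X"
    and B: "L2_tendsto M B Y F" "\<And>s. square_integrable M (B s)" "square_integrable M Y"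
  shows "L2_tendsto M (\<lambda>s \<omega>. A s \<omega> - B s \<omega>) (\<lambda>\<omega>. X \<omega> - Y \<omega>) F"
  unfolding L2_tendsto_def
proof (rule Lim_null_comparison)
  let ?e = "\<lambda>s. 2 * integral\<^sup>L M (\<lambda>\<omega>. (A s \<omega> - X \<omega>)\<^sup>2) + 2 * integral\<^sup>L M (\<lambda>\<omega>. (B s \<omega> - Y \<omega>)\<^sup>2)"
  show "(?e \<longlongrightarrow> 0) F"
    using tendsto_add[OF tendsto_mult_right_zero tendsto_mult_right_zero,
      OF A(1)[unfolded L2_tendsto_def] B(1)[unfolded L2_tendsto_def]] by simp
  have "integral\<^sup>L M (\<lambda>\<omega>. (A s \<omega> - B s \<omega> - (X \<omega> - Y \<omega>))\<^sup>2) \<le> ?e s" for s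
    using L2_norm_diff_le[OF square_integrable_diff[OF A(2) A(3)] square_integrable_diff[OF B(2) B(3)], of s s]
    by (simp add: algebra_simps)
  then show "\<forall>\<^sub>F s in F. norm (integral\<^sup>L M (\<lambda>\<omega>. (A s \<omega> - B s \<omega> - (X \<omega> - Y \<omega>))\<^sup>2)) \<le> ?e s"
    by (intro always_eventually) auto
qed

section \<open>Completeness\<close>

text \<open>
  The Riesz-Fischer argument: along a subsequence with geometrically decreasing steps the
  increments are absolutely summable almost surely, which gives a pointwise limit; Fatou's lemma
  then bounds its distance to every late term of the whole sequence.
\<close>
lemma (in prob_space) L2_complete:
  fixes X :: "nat \<Rightarrow> 'a \<Rightarrow> real"
  assumes sq: "\<And>n. square_integrable M (X n)"
    and Cauchy: "\<And>e. e > 0 \<Longrightarrow> \<exists>N. \<forall>m\<ge>N. \<forall>n\<ge>N. integral\<^sup>L M (\<lambda>\<omega>. (X m \<omega> - X n \<omega>)\<^sup>2) \<le> e"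
  shows "\<exists>Y. square_integrable M Y \<and> L2_tendsto M X Y sequentially"
proof -
  have [measurable]: "X n \<in> borel_measurable M" for n using sq by (simp add: square_integrable_def)
  have int: "integrable M (\<lambda>\<omega>. (X m \<omega> - X n \<omega>)\<^sup>2)" for m n
    using square_integrable_diff[OF sq sq] by (auto simp: square_integrable_def)
  have "\<exists>N. \<forall>k. \<forall>m\<ge>N k. \<forall>n\<ge>N k. integral\<^sup>L M (\<lambda>\<omega>. (X m \<omega> - X n \<omega>)\<^sup>2) \<le> (1/4)^k"
    by (intro choice allI Cauchy) simp
  then obtain N where
    N: "\<And>k m n. m \<ge> N k \<Longrightarrow> n \<ge> N k \<Longrightarrow> integral\<^sup>L M (\<lambda>\<omega>. (X m \<omega> - X n \<omega>)\<^sup>2) \<le> (1/4)^k"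
    by blast
  \<comment> \<open>Summing the thresholds makes \<open>r\<close> nondecreasing, so that \<open>r (Suc k)\<close> also passes \<open>N k\<close>; the summand
     \<open>k\<close> makes it unbounded.\<close>
  define r where "r k = k + (\<Sum>j\<le>k. N j)" for k :: nat
  have r: "N k \<le> r k" "N k \<le> r (Suc k)" "k \<le> r k" for k
    using member_le_sum[of k "{..k}" N] by (auto simp: r_def)
  define d where "d k \<omega> = X (r (Suc k)) \<omega> - X (r k) \<omega>" for k \<omega>
  have d_sq: "square_integrable M (d k)" for k
    unfolding d_def using sq by auto
  have [measurable]: "d k \<in> borel_measurable M" for k using d_sq by (simp add: square_integrable_def)
  have d_int: "integrable M (\<lambda>\<omega>. \<bar>d k \<omega>\<bar>)" for k
    using square_integrable_imp_integrable[of "d k"] d_sq[of k] by (simp add: square_integrable_def)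
  have d_abs: "square_integrable M (\<lambda>\<omega>. \<bar>d k \<omega>\<bar>)" for k
    using d_sq[of k] by (auto simp: square_integrable_def)
  have d_le: "integral\<^sup>L M (\<lambda>\<omega>. \<bar>d k \<omega>\<bar>) \<le> (1/2)^k" for k
  proof (rule power2_le_imp_le)
    have "(integral\<^sup>L M (\<lambda>\<omega>. \<bar>d k \<omega>\<bar>))\<^sup>2 \<le> integral\<^sup>L M (\<lambda>\<omega>. (d k \<omega>)\<^sup>2)"
      using L2_Cauchy_Schwarz[OF d_abs[of k] square_integrable_const[of 1]]
      by (simp add: L2_inner_def prob_space power2_eq_square abs_mult_self_eq)
    also have "\<dots> \<le> (1/4)^k" unfolding d_def using r N by blast
    also have "\<dots> = ((1/2)^k)\<^sup>2" by (simp flip: power_mult add: mult.commute[of k 2]) (simp add: power_mult power2_eq_square)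
    finally show "(integral\<^sup>L M (\<lambda>\<omega>. \<bar>d k \<omega>\<bar>))\<^sup>2 \<le> ((1/2)^k)\<^sup>2" .
  qed simp
  have "(\<integral>\<^sup>+\<omega>. (\<Sum>k. ennreal \<bar>d k \<omega>\<bar>) \<partial>M) = (\<Sum>k. \<integral>\<^sup>+\<omega>. ennreal \<bar>d k \<omega>\<bar> \<partial>M)"
    by (intro nn_integral_suminf) auto
  also have "\<dots> = (\<Sum>k. ennreal (integral\<^sup>L M (\<lambda>\<omega>. \<bar>d k \<omega>\<bar>)))"
    by (intro suminf_cong nn_integral_eq_integral d_int) auto
  also have "\<dots> \<le> (\<Sum>k. ennreal ((1/2)^k))"
    by (intro suminf_le summableI ennreal_leI d_le)
  also have "\<dots> = ennreal (\<Sum>k. (1/2)^k)"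
    by (intro suminf_ennreal2 summable_geometric) auto
  also have "\<dots> < \<infinity>" by simp
  finally have "AE \<omega> in M. (\<Sum>k. ennreal \<bar>d k \<omega>\<bar>) \<noteq> \<infinity>"
    by (intro nn_integral_noteq_infinite) auto
  then have conv: "AE \<omega> in M. convergent (\<lambda>k. X (r k) \<omega>)"
  proof eventually_elim
    case (elim \<omega>)
    have "summable (\<lambda>k. \<bar>d k \<omega>\<bar>)"
      using elim by (intro summable_suminf_not_top) auto
    then have "summable (\<lambda>k. d k \<omega>)" by (rule summable_rabs_cancel)
    then have "convergent (\<lambda>n. \<Sum>k<n. d k \<omega>)" by (simp add: summable_iff_convergent)
    then have "convergent (\<lambda>n. X (r n) \<omega> - X (r 0) \<omega>)"
      unfolding d_def sum_lessThan_telescope[of "\<lambda>k. X (r k) \<omega>"] .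
    then show ?case by (simp add: convergent_diff_const_right_iff)
  qed
  define Y where "Y \<omega> = lim (\<lambda>k. X (r k) \<omega>)" for \<omega>
  have [measurable]: "Y \<in> borel_measurable M" unfolding Y_def by measurable
  have Fatou: "(\<integral>\<^sup>+\<omega>. ennreal ((X n \<omega> - Y \<omega>)\<^sup>2) \<partial>M) \<le> ennreal e"
    if e: "\<forall>m\<ge>K. integral\<^sup>L M (\<lambda>\<omega>. (X n \<omega> - X m \<omega>)\<^sup>2) \<le> e" for e n K
  proof -
    have "(\<integral>\<^sup>+\<omega>. ennreal ((X n \<omega> - Y \<omega>)\<^sup>2) \<partial>M)
      = (\<integral>\<^sup>+\<omega>. liminf (\<lambda>k. ennreal ((X n \<omega> - X (r k) \<omega>)\<^sup>2)) \<partial>M)"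
    proof (rule nn_integral_cong_AE)
      show "AE \<omega> in M. ennreal ((X n \<omega> - Y \<omega>)\<^sup>2) = liminf (\<lambda>k. ennreal ((X n \<omega> - X (r k) \<omega>)\<^sup>2))"
        using conv
      proof eventually_elim
        case (elim \<omega>)
        then have "(\<lambda>k. X (r k) \<omega>) \<longlonglongrightarrow> Y \<omega>" by (simp add: Y_def convergent_LIMSEQ_iff)
        then have "(\<lambda>k. ennreal ((X n \<omega> - X (r k) \<omega>)\<^sup>2)) \<longlonglongrightarrow> ennreal ((X n \<omega> - Y \<omega>)\<^sup>2)"
          by (intro tendsto_intros)
        then show ?case using lim_imp_Liminf[OF sequentially_bot] by metis
      qed
    qed
    also have "\<dots> \<le> liminf (\<lambda>k. \<integral>\<^sup>+\<omega>. ennreal ((X n \<omega> - X (r k) \<omega>)\<^sup>2) \<partial>M)"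
      by (rule nn_integral_liminf) auto
    also have "\<dots> \<le> limsup (\<lambda>k. \<integral>\<^sup>+\<omega>. ennreal ((X n \<omega> - X (r k) \<omega>)\<^sup>2) \<partial>M)"
      by (rule Liminf_le_Limsup) simp
    also have "\<dots> \<le> ennreal e"
    proof (rule Limsup_bounded)
      show "\<forall>\<^sub>F k in sequentially. (\<integral>\<^sup>+\<omega>. ennreal ((X n \<omega> - X (r k) \<omega>)\<^sup>2) \<partial>M) \<le> ennreal e"
        using eventually_ge_at_top[of K]
      proof eventually_elim
        case (elim k)
        then have "K \<le> r k" using r(3)[of k] by linarith
        then show ?case using e int by (subst nn_integral_eq_integral) (auto intro: ennreal_leI)
      qed
    qed
    finally show ?thesis .
  qed
  have bound: "integrable M (\<lambda>\<omega>. (X n \<omega> - Y \<omega>)\<^sup>2) \<and> integral\<^sup>L M (\<lambda>\<omega>. (X n \<omega> - Y \<omega>)\<^sup>2) \<le> e"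
    if e: "e > 0" "\<forall>m\<ge>K. integral\<^sup>L M (\<lambda>\<omega>. (X n \<omega> - X m \<omega>)\<^sup>2) \<le> e" for e n K
  proof
    show *: "integrable M (\<lambda>\<omega>. (X n \<omega> - Y \<omega>)\<^sup>2)"
      using Fatou[OF e(2)] by (intro integrableI_bounded) (auto simp: less_top[symmetric] top_unique)
    show "integral\<^sup>L M (\<lambda>\<omega>. (X n \<omega> - Y \<omega>)\<^sup>2) \<le> e"
      using Fatou[OF e(2)] e(1) by (subst (asm) nn_integral_eq_integral[OF *]) auto
  qed
  obtain K where K: "\<forall>m\<ge>K. \<forall>n\<ge>K. integral\<^sup>L M (\<lambda>\<omega>. (X m \<omega> - X n \<omega>)\<^sup>2) \<le> 1"
    using Cauchy[of 1] by auto
  have "square_integrable M (\<lambda>\<omega>. X K \<omega> - Y \<omega>)"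
    using bound[of 1 K K] K by (auto simp: square_integrable_def)
  from square_integrable_diff[OF sq[of K] this] have Y: "square_integrable M Y" by simp
  have "L2_tendsto M X Y sequentially"
    unfolding L2_tendsto_def
  proof (rule LIMSEQ_I)
    fix e :: real assume "e > 0"
    then obtain K where K: "\<forall>m\<ge>K. \<forall>n\<ge>K. integral\<^sup>L M (\<lambda>\<omega>. (X m \<omega> - X n \<omega>)\<^sup>2) \<le> e/2"
      using Cauchy[of "e/2"] by auto
    have "norm (integral\<^sup>L M (\<lambda>\<omega>. (X n \<omega> - Y \<omega>)\<^sup>2) - 0) < e" if "n \<ge> K" for n
      using bound[of "e/2" K n] K that \<open>e > 0\<close> by auto
    then show "\<exists>no. \<forall>n\<ge>no. norm (integral\<^sup>L M (\<lambda>\<omega>. (X n \<omega> - Y \<omega>)\<^sup>2) - 0) < e" by blast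
  qed
  with Y show ?thesis by blast
qed

lemma (in prob_space) L2_complete_at_0:
  fixes D :: "real \<Rightarrow> 'a \<Rightarrow> real"
  assumes sq: "\<And>s. square_integrable M (D s)"
    and Cauchy: "\<And>e. e > 0 \<Longrightarrow> \<exists>\<delta>>0. \<forall>s t. 0 < \<bar>s\<bar> \<and> \<bar>s\<bar> < \<delta> \<and> 0 < \<bar>t\<bar> \<and> \<bar>t\<bar> < \<delta> \<longrightarrow>
      integral\<^sup>L M (\<lambda>\<omega>. (D s \<omega> - D t \<omega>)\<^sup>2) \<le> e"
  shows "\<exists>Y. square_integrable M Y \<and> L2_tendsto M D Y (at 0)"
proof -
  define X where "X n = D (inverse (real (Suc n)))" for n
  have small: "\<exists>N. \<forall>n\<ge>N. \<bar>inverse (real (Suc n))\<bar> < \<delta>" if "\<delta> > 0" for \<delta> :: real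
    using LIMSEQ_D[OF LIMSEQ_inverse_real_of_nat that] by auto
  have "\<exists>N. \<forall>m\<ge>N. \<forall>n\<ge>N. integral\<^sup>L M (\<lambda>\<omega>. (X m \<omega> - X n \<omega>)\<^sup>2) \<le> e" if e: "e > 0" for e
  proof -
    obtain \<delta> where \<delta>: "\<delta> > 0" "\<And>s t. 0 < \<bar>s\<bar> \<Longrightarrow> \<bar>s\<bar> < \<delta> \<Longrightarrow> 0 < \<bar>t\<bar> \<Longrightarrow> \<bar>t\<bar> < \<delta> \<Longrightarrow>
      integral\<^sup>L M (\<lambda>\<omega>. (D s \<omega> - D t \<omega>)\<^sup>2) \<le> e" using Cauchy[OF e] by auto
    obtain N where "\<forall>n\<ge>N. \<bar>inverse (real (Suc n))\<bar> < \<delta>" using small[OF \<delta>(1)] by auto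
    then show ?thesis unfolding X_def by (intro exI[of _ N] allI impI \<delta>(2)) auto
  qed
  then obtain Y where Y: "square_integrable M Y" "L2_tendsto M X Y sequentially"
    using L2_complete[of X] sq by (auto simp: X_def)
  have "L2_tendsto M D Y (at 0)"
    unfolding L2_tendsto_def
  proof (rule LIM_I)
    fix e :: real assume e: "e > 0"
    obtain \<delta> where \<delta>: "\<delta> > 0" "\<And>s t. 0 < \<bar>s\<bar> \<Longrightarrow> \<bar>s\<bar> < \<delta> \<Longrightarrow> 0 < \<bar>t\<bar> \<Longrightarrow> \<bar>t\<bar> < \<delta> \<Longrightarrow>
      integral\<^sup>L M (\<lambda>\<omega>. (D s \<omega> - D t \<omega>)\<^sup>2) \<le> e/8" using Cauchy[of "e/8"] e by auto
    obtain N where N: "\<forall>n\<ge>N. \<bar>inverse (real (Suc n))\<bar> < \<delta>" using small[OF \<delta>(1)] by auto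
    obtain N' where N': "\<forall>n\<ge>N'. norm (integral\<^sup>L M (\<lambda>\<omega>. (X n \<omega> - Y \<omega>)\<^sup>2) - 0) < e/8"
      using LIMSEQ_D[OF Y(2)[unfolded L2_tendsto_def], of "e/8"] e by auto
    define n where "n = max N N'"
    have XY: "integral\<^sup>L M (\<lambda>\<omega>. (Y \<omega> - X n \<omega>)\<^sup>2) < e/8"
      using N' by (simp add: n_def power2_commute[of "Y _"])
    have "norm (integral\<^sup>L M (\<lambda>\<omega>. (D s \<omega> - Y \<omega>)\<^sup>2) - 0) < e"
      if "s \<noteq> 0" "norm (s - 0) < \<delta>" for s
    proof -
      have "integral\<^sup>L M (\<lambda>\<omega>. (D s \<omega> - X n \<omega>)\<^sup>2) \<le> e/8"
        unfolding X_def using that N by (intro \<delta>(2)) (auto simp: n_def)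
      moreover have "integral\<^sup>L M (\<lambda>\<omega>. (D s \<omega> - Y \<omega>)\<^sup>2)
        \<le> 2 * integral\<^sup>L M (\<lambda>\<omega>. (D s \<omega> - X n \<omega>)\<^sup>2) + 2 * integral\<^sup>L M (\<lambda>\<omega>. (Y \<omega> - X n \<omega>)\<^sup>2)"
        using L2_norm_diff_le[of M "\<lambda>\<omega>. D s \<omega> - X n \<omega>" "\<lambda>\<omega>. Y \<omega> - X n \<omega>"] sq Y(1)
        by (simp add: X_def square_integrable_diff)
      ultimately show ?thesis using XY e by simp
    qed
    then show "\<exists>\<delta>>0. \<forall>s. s \<noteq> 0 \<and> norm (s - 0) < \<delta> \<longrightarrow> norm (integral\<^sup>L M (\<lambda>\<omega>. (D s \<omega> - Y \<omega>)\<^sup>2) - 0) < e"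
      using \<delta>(1) by blast
  qed
  with Y(1) show ?thesis by blast
qed

section \<open>Mean-square differentiability of stationary processes\<close>

text \<open>
  In terms of the remainder \<open>m(r) = \<kappa>(r) - \<kappa>(0) - l r\<^sup>2\<close>, the squared distance of the difference
  quotients with steps s and t is, up to nonpositive terms, the mixed difference
  \<open>m(s) + m(t) - m(s - t)\<close> divided by \<open>s t / 2\<close>. Knowing \<open>m(r) = o(r\<^sup>2)\<close> at 0 is by
  itself not enough to control this quotient when s is much smaller than t. The missing
  information comes from the Cauchy-Schwarz inequality for increments of G, which says that m has
  nonnegative second differences: a difference of m over a short step s is then dominated by the
  average difference over the much longer stretch from t to 2t, where the bound \<open>o(t\<^sup>2)\<close> applies.
\<close>
lemma (in prob_space) stationary_L2_differentiable:
  fixes G :: "real \<Rightarrow> 'a \<Rightarrow> real" and \<kappa> :: "real \<Rightarrow> real"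
  assumes sq: "\<And>s. square_integrable M (G s)"
    and cov: "\<And>s t. L2_inner M (G s) (G t) = \<kappa> (s - t)"
    and Peano: "((\<lambda>r. (\<kappa> r - \<kappa> 0) / r\<^sup>2) \<longlongrightarrow> l) (at 0)"
  shows "\<exists>X. square_integrable M X \<and> L2_tendsto M (\<lambda>t \<omega>. (G t \<omega> - G 0 \<omega>) / t) X (at 0)"
proof -
  have even_\<kappa>: "\<kappa> (- r) = \<kappa> r" for r
    using cov[of 0 r] cov[of r 0] by (simp add: L2_inner_commute)
  define m where "m r = \<kappa> r - \<kappa> 0 - l * r\<^sup>2" for r
  have m0: "m 0 = 0" and even: "m (- r) = m r" for r by (auto simp: m_def even_\<kappa>)
  have incr: "L2_inner M (\<lambda>\<omega>. G s \<omega> - G t \<omega>) (\<lambda>\<omega>. G s' \<omega> - G t' \<omega>)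
      = \<kappa> (s - s') - \<kappa> (s - t') - \<kappa> (t - s') + \<kappa> (t - t')" for s t s' t'
    using sq by (simp add: L2_inner_diff_left L2_inner_diff_right square_integrable_diff cov)
  \<comment> \<open>Two increments of length \<open>s\<close> have the same norm, so their inner product, minus a
     second difference of \<open>\<kappa>\<close>, is largest when they coincide.\<close>
  have second_diff: "2 * m s \<le> m (r + s) + m (r - s) - 2 * m r" for r s
  proof -
    let ?A = "\<lambda>\<omega>. G (r + s) \<omega> - G r \<omega>" and ?B = "\<lambda>\<omega>. G s \<omega> - G 0 \<omega>"
    have AA: "L2_inner M ?A ?A = 2 * \<kappa> 0 - 2 * \<kappa> s" and BB: "L2_inner M ?B ?B = 2 * \<kappa> 0 - 2 * \<kappa> s"
      unfolding incr using even_\<kappa>[of s] by simp_all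
    have "L2_inner M ?A ?B \<le> sqrt (L2_inner M ?A ?A) * sqrt (L2_inner M ?B ?B)"
      using L2_inner_abs_le[of M ?A ?B] sq by (auto simp: square_integrable_diff)
    also have "\<dots> = 2 * \<kappa> 0 - 2 * \<kappa> s"
      using L2_inner_self_nonneg[of M ?A] unfolding AA BB by simp
    finally have "2 * \<kappa> r - \<kappa> (r + s) - \<kappa> (r - s) \<le> 2 * \<kappa> 0 - 2 * \<kappa> s"
      unfolding incr by simp
    then show ?thesis by (simp add: m_def power2_eq_square algebra_simps)
  qed
  have m_o: "((\<lambda>r. m r / r\<^sup>2) \<longlongrightarrow> 0) (at 0)"
  proof (rule Lim_transform_eventually)
    show "((\<lambda>r. (\<kappa> r - \<kappa> 0) / r\<^sup>2 - l) \<longlongrightarrow> 0) (at 0)"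
      using tendsto_diff[OF Peano tendsto_const[of l]] by simp
    show "\<forall>\<^sub>F r in at 0. (\<kappa> r - \<kappa> 0) / r\<^sup>2 - l = m r / r\<^sup>2"
      by (simp add: eventually_at m_def field_simps) (meson zero_less_one)
  qed
  have nonneg: "0 \<le> m s" for s
  proof (cases "s = 0")
    case False
    \<comment> \<open>Halving the argument does not increase \<open>m(s)/s\<^sup>2\<close>, whose limit at 0 vanishes.\<close>
    have double: "4 * m r \<le> m (2 * r)" for r using second_diff[of r r] m0 by simp
    have "m (s / 2^k) / (s / 2^k)\<^sup>2 \<le> m s / s\<^sup>2" for k
    proof (induction k)
      case (Suc k)
      have "4 * m (s / 2^Suc k) \<le> m (s / 2^k)" using double[of "s / 2^Suc k"] by simp
      then have "m (s / 2^Suc k) / (s / 2^Suc k)\<^sup>2 \<le> m (s / 2^k) / (s / 2^k)\<^sup>2"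
        using divide_right_mono[of "4 * m (s / 2^Suc k)" "m (s / 2^k)" "(s / 2^k)\<^sup>2"]
        by (simp add: power_divide power_mult_distrib mult.commute mult.left_commute)
      with Suc show ?case by linarith
    qed simp
    moreover have "(\<lambda>k. m (s / 2^k) / (s / 2^k)\<^sup>2) \<longlonglongrightarrow> 0"
    proof (rule filterlim_compose[OF m_o])
      have "(\<lambda>k. s * (1/2)^k) \<longlonglongrightarrow> s * 0"
        by (intro tendsto_intros LIMSEQ_power_zero) simp
      then have "(\<lambda>k. s / 2^k) \<longlonglongrightarrow> 0" by (simp add: power_divide)
      then show "filterlim (\<lambda>k. s / 2^k) (at 0) sequentially"
        using False by (intro filterlim_atI) auto
    qed
    ultimately have "0 \<le> m s / s\<^sup>2" by (intro LIMSEQ_le_const2) auto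
    then show ?thesis using False by (simp add: zero_le_divide_iff)
  qed (simp add: m0)
  have convex: "m r - m (r - s) \<le> m (r + s) - m r" for r s
    using second_diff[of s r] nonneg[of s] by linarith
  have slope: "real n * (m (t + s) - m t) \<le> m (t + real n * s) - m t" for n t s
  proof -
    have step: "m (t + s) - m t \<le> m (t + real (Suc k) * s) - m (t + real k * s)" for k
    proof (induction k)
      case (Suc k)
      then show ?case using convex[of "t + real (Suc k) * s" s] by (simp add: algebra_simps)
    qed simp
    show ?thesis
    proof (induction n)
      case (Suc n)
      then show ?case using step[of n] by (simp add: algebra_simps)
    qed simp
  qed
  have key: "\<exists>\<delta>>0. \<forall>s t. 0 < s \<and> s \<le> t \<and> t < \<delta> \<longrightarrow> m (t + s) - m t \<le> e * s * t \<and> m s \<le> e * s * t"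
    if e: "e > 0" for e
  proof -
    obtain \<delta> where \<delta>: "\<delta> > 0" "\<And>r. r \<noteq> 0 \<Longrightarrow> norm (r - 0) < \<delta> \<Longrightarrow> norm (m r / r\<^sup>2 - 0) < e/8"
      using LIM_D[OF m_o, of "e/8"] e by auto
    have small: "m r \<le> e/8 * r\<^sup>2" if "0 < r" "r < \<delta>" for r
      using \<delta>(2)[of r] that nonneg[of r] by (simp add: field_simps)
    have "m (t + s) - m t \<le> e * s * t \<and> m s \<le> e * s * t" if st: "0 < s" "s \<le> t" "t < \<delta>/2" for s t
    proof
      \<comment> \<open>The number of steps of length \<open>s\<close> that carry \<open>t\<close> into the interval from \<open>3t/2\<close> to \<open>2t\<close>.\<close>
      define n where "n = nat \<lfloor>t / s\<rfloor>"
      have "1 \<le> t / s" using st by simp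
      then have rn: "real n = of_int \<lfloor>t / s\<rfloor>" and fl: "1 \<le> \<lfloor>t / s\<rfloor>" by (simp_all add: n_def)
      have n1: "1 \<le> real n" using fl rn by linarith
      have n2: "real n \<le> t / s" using rn by linarith
      have n3: "t / s \<le> real n + 1" using rn by linarith
      have "t \<le> real n * s + s" "s \<le> real n * s" and ns1: "real n * s \<le> t"
        using st n1 n2 n3 by (simp_all add: field_simps)
      then have ns: "real n * s \<le> t" "t \<le> 2 * (real n * s)" by linarith+
      have pos: "0 < real n" using n1 by simp
      have "(t + real n * s)\<^sup>2 \<le> (2 * t)\<^sup>2" using ns st by (intro power_mono) auto
      then have "e/8 * (t + real n * s)\<^sup>2 \<le> e/8 * (2 * t)\<^sup>2" using e by (intro mult_left_mono) auto
      moreover have "m (t + real n * s) \<le> e/8 * (t + real n * s)\<^sup>2"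
        using small[of "t + real n * s"] ns st by auto
      ultimately have "m (t + real n * s) \<le> e/8 * (2 * t)\<^sup>2" by linarith
      also have "\<dots> = (e * t / 2) * t" by (simp add: power2_eq_square)
      also have "\<dots> \<le> (e * t / 2) * (2 * (real n * s))" using ns e st by (intro mult_left_mono) auto
      finally have "real n * (m (t + s) - m t) \<le> real n * (e * s * t)"
        using slope[of n t s] nonneg[of t] by (simp add: algebra_simps)
      then show "m (t + s) - m t \<le> e * s * t" using pos by simp
      have "m s \<le> e/8 * s\<^sup>2" using small[of s] st by simp
      also have "\<dots> \<le> e * s\<^sup>2" using e by simp
      also have "\<dots> \<le> e * s * t" using st e by (simp add: power2_eq_square)
      finally show "m s \<le> e * s * t" .
    qed
    then show ?thesis using \<delta>(1) by (intro exI[of _ "\<delta>/2"]) auto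
  qed
  let ?D = "\<lambda>t \<omega>. (G t \<omega> - G 0 \<omega>) / t"
  have D_sq: "square_integrable M (?D t)" for t
    by (intro square_integrable_divide square_integrable_diff sq)
  have dist: "integral\<^sup>L M (\<lambda>\<omega>. (?D s \<omega> - ?D t \<omega>)\<^sup>2)
      = 2 * (- (m (s - t) - m s - m t) / (s * t)) - 2 * (m s / s\<^sup>2) - 2 * (m t / t\<^sup>2)"
    if "s \<noteq> 0" "t \<noteq> 0" for s t
    using that unfolding L2_inner_diff_self[OF D_sq D_sq] L2_inner_divide_left L2_inner_divide_right incr
    by (simp add: m_def even_\<kappa> divide_simps) (simp add: power2_eq_square algebra_simps)
  show ?thesis
  proof (rule L2_complete_at_0[OF D_sq])
    fix e :: real assume "e > 0"
    then obtain \<delta> where \<delta>: "\<delta> > 0" "\<And>s t. 0 < s \<Longrightarrow> s \<le> t \<Longrightarrow> t < \<delta> \<Longrightarrow>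
        m (t + s) - m t \<le> (e/4) * s * t \<and> m s \<le> (e/4) * s * t"
      using key[of "e/4"] by auto
    have ordered: "integral\<^sup>L M (\<lambda>\<omega>. (?D s \<omega> - ?D t \<omega>)\<^sup>2) \<le> e"
      if st: "0 < \<bar>s\<bar>" "\<bar>s\<bar> \<le> \<bar>t\<bar>" "\<bar>t\<bar> < \<delta>" for s t
    proof -
      have abs: "m \<bar>r\<bar> = m r" for r by (simp add: abs_if even)
      have K: "m (\<bar>t\<bar> + \<bar>s\<bar>) - m t \<le> (e/4) * \<bar>s\<bar> * \<bar>t\<bar>" "m s \<le> (e/4) * \<bar>s\<bar> * \<bar>t\<bar>"
        using \<delta>(2)[OF st] by (simp_all add: abs)
      \<comment> \<open>Steps of equal sign lead to a backward difference of \<open>m\<close> at \<open>\<bar>t\<bar>\<close>, which convexity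
         bounds by the forward one; steps of opposite sign give the forward one at once.\<close>
      have R: "- (m (s - t) - m s - m t) / (s * t) \<le> e/2"
      proof (cases "s * t > 0")
        case True
        then have "m (s - t) = m (\<bar>t\<bar> - \<bar>s\<bar>)" "\<bar>s\<bar> * \<bar>t\<bar> = s * t"
          using even[of "s - t"] by (auto simp: zero_less_mult_iff)
        then have "- (m (s - t) - m s - m t) \<le> (e/2) * (s * t)"
          using K convex[of "\<bar>t\<bar>" "\<bar>s\<bar>"] by (simp add: abs algebra_simps)
        then show ?thesis using True by (simp add: pos_divide_le_eq)
      next
        case False
        moreover have "s * t \<noteq> 0" using st by auto
        ultimately have neg: "s * t < 0" by linarith
        then have "m (s - t) = m (\<bar>t\<bar> + \<bar>s\<bar>)" "\<bar>s\<bar> * \<bar>t\<bar> = - (s * t)"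
          using even[of "s - t"] by (auto simp: mult_less_0_iff add.commute)
        then have "- (m (s - t) - m s - m t) \<ge> (e/2) * (s * t)"
          using K(1) nonneg[of s] mult_pos_neg[OF \<open>e > 0\<close> neg] by (simp add: mult.assoc)
        then show ?thesis using neg by (simp add: neg_divide_le_eq)
      qed
      have "s \<noteq> 0" "t \<noteq> 0" using st by auto
      moreover have "0 \<le> m s / s\<^sup>2" "0 \<le> m t / t\<^sup>2" using nonneg by auto
      ultimately show ?thesis using R dist[of s t] by linarith
    qed
    have "integral\<^sup>L M (\<lambda>\<omega>. (?D s \<omega> - ?D t \<omega>)\<^sup>2) \<le> e"
      if "0 < \<bar>s\<bar>" "\<bar>s\<bar> < \<delta>" "0 < \<bar>t\<bar>" "\<bar>t\<bar> < \<delta>" for s t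
      using ordered[of s t] ordered[of t s] that by (cases "\<bar>s\<bar> \<le> \<bar>t\<bar>") (auto simp: power2_commute)
    with \<delta>(1) show "\<exists>\<delta>>0. \<forall>s t. 0 < \<bar>s\<bar> \<and> \<bar>s\<bar> < \<delta> \<and> 0 < \<bar>t\<bar> \<and> \<bar>t\<bar> < \<delta> \<longrightarrow>
        integral\<^sup>L M (\<lambda>\<omega>. (?D s \<omega> - ?D t \<omega>)\<^sup>2) \<le> e"
      by blast
  qed
qed

section \<open>Mean-square derivatives\<close>

lemma (in prob_space) gaussian_rv_square_integrable:
  assumes "gaussian_rv M X"
  shows "square_integrable M X"
proof -
  have X[measurable]: "X \<in> borel_measurable M" using assms by (simp add: gaussian_rv_def)
  from assms consider (const) \<mu> where "AE \<omega> in M. X \<omega> = \<mu>"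
    | (normal) \<mu> \<sigma> where "\<sigma> > 0" "distributed M lborel X (normal_density \<mu> \<sigma>)"
    by (auto simp: gaussian_rv_def)
  then show ?thesis
  proof cases
    case const
    then have "AE \<omega> in M. (X \<omega>)\<^sup>2 = \<mu>\<^sup>2" by eventually_elim simp
    then have "integrable M (\<lambda>\<omega>. (X \<omega>)\<^sup>2) \<longleftrightarrow> integrable M (\<lambda>_. \<mu>\<^sup>2)"
      by (intro integrable_cong_AE) auto
    then show ?thesis using X by (simp add: square_integrable_def)
  next
    case normal
    have "integrable M (\<lambda>\<omega>. (X \<omega> - \<mu>)\<^sup>2)"
      using integrable_normal_moment[OF normal(1), of \<mu> 2]
        distributed_integrable[OF normal(2), of "\<lambda>x. (x - \<mu>)\<^sup>2"] by simp
    then have "square_integrable M (\<lambda>\<omega>. X \<omega> - \<mu>)"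
      by (auto simp: square_integrable_def)
    from square_integrable_add[OF this square_integrable_const[of \<mu>]] show ?thesis by simp
  qed
qed

lemma (in prob_space) gaussian_field_square_integrable:
  assumes "gaussian_field M F"
  shows "square_integrable M (F p)"
proof -
  have "gaussian_rv M (\<lambda>\<omega>. \<Sum>x\<in>{p}. 1 * F x \<omega>)"
    using assms[unfolded gaussian_field_def, rule_format, of "{p}" "\<lambda>_. 1"] by simp
  then show ?thesis by (intro gaussian_rv_square_integrable) simp
qed

lemma has_ms_derivative_iff:
  "has_ms_derivative M F e x X \<longleftrightarrow> (\<forall>y. square_integrable M (F y)) \<and> square_integrable M X \<and>
     L2_tendsto M (\<lambda>t \<omega>. (F (x + t *\<^sub>R e) \<omega> - F x \<omega>) / t) X (at 0)"
  by (simp add: has_ms_derivative_def L2_tendsto_def)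

lemma has_ms_derivative_square_integrable:
  assumes "has_ms_derivative M F e x X"
  shows "square_integrable M (F y)" "square_integrable M X"
  using assms by (auto simp: has_ms_derivative_iff)

lemma ms_deriv_works:
  "has_ms_derivative M F e x X \<Longrightarrow> has_ms_derivative M F e x (ms_deriv M e F x)"
  unfolding ms_deriv_def by (rule someI[of "has_ms_derivative M F e x"])

lemma has_ms_derivative_unique_AE:
  assumes X: "has_ms_derivative M F e x X" and Y: "has_ms_derivative M F e x Y"
  shows "AE \<omega> in M. X \<omega> = Y \<omega>"
proof (rule L2_limit_unique_AE)
  show "L2_tendsto M (\<lambda>t \<omega>. (F (x + t *\<^sub>R e) \<omega> - F x \<omega>) / t) X (at 0)"
    "L2_tendsto M (\<lambda>t \<omega>. (F (x + t *\<^sub>R e) \<omega> - F x \<omega>) / t) Y (at 0)"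
    using X Y by (auto simp: has_ms_derivative_iff)
  show "square_integrable M (\<lambda>\<omega>. (F (x + s *\<^sub>R e) \<omega> - F x \<omega>) / s)" for s
    by (intro square_integrable_divide square_integrable_diff has_ms_derivative_square_integrable[OF X])
qed (auto intro: has_ms_derivative_square_integrable[OF X] has_ms_derivative_square_integrable[OF Y])

lemma has_ms_derivative_cong_AE:
  assumes F: "has_ms_derivative M F e x X"
    and eq: "\<And>y. AE \<omega> in M. F y \<omega> = F' y \<omega>" and sq: "\<And>y. square_integrable M (F' y)"
  shows "has_ms_derivative M F' e x X"
proof -
  have [measurable]: "F y \<in> borel_measurable M" "F' y \<in> borel_measurable M" "X \<in> borel_measurable M" for y
    using has_ms_derivative_square_integrable[OF F] sq by (auto simp: square_integrable_def)
  have "integral\<^sup>L M (\<lambda>\<omega>. ((F (x + t *\<^sub>R e) \<omega> - F x \<omega>) / t - X \<omega>)\<^sup>2)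
      = integral\<^sup>L M (\<lambda>\<omega>. ((F' (x + t *\<^sub>R e) \<omega> - F' x \<omega>) / t - X \<omega>)\<^sup>2)" for t
  proof (rule integral_cong_AE)
    show "AE \<omega> in M. ((F (x + t *\<^sub>R e) \<omega> - F x \<omega>) / t - X \<omega>)\<^sup>2
      = ((F' (x + t *\<^sub>R e) \<omega> - F' x \<omega>) / t - X \<omega>)\<^sup>2"
      using eq[of "x + t *\<^sub>R e"] eq[of x] by eventually_elim simp
  qed measurable
  then show ?thesis using F sq by (simp add: has_ms_derivative_def)
qed

lemma has_ms_derivative_diff_flip:
  fixes F F' :: "'a::real_normed_vector \<times> 'a \<Rightarrow> 'w \<Rightarrow> real"
  assumes F: "has_ms_derivative M F e x X" and F': "has_ms_derivative M F' (flip e) (flip x) X'"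
  shows "has_ms_derivative M (\<lambda>p \<omega>. F p \<omega> - F' (flip p) \<omega>) e x (\<lambda>\<omega>. X \<omega> - X' \<omega>)"
proof -
  note sq = has_ms_derivative_square_integrable[OF F] has_ms_derivative_square_integrable[OF F']
  have flip: "flip (x + t *\<^sub>R e) = flip x + t *\<^sub>R flip e" for t by (simp add: prod_eq_iff)
  have "L2_tendsto M (\<lambda>t \<omega>. (F (x + t *\<^sub>R e) \<omega> - F x \<omega>) / t
      - (F' (flip x + t *\<^sub>R flip e) \<omega> - F' (flip x) \<omega>) / t) (\<lambda>\<omega>. X \<omega> - X' \<omega>) (at 0)"
    using F F' sq by (intro L2_tendsto_diff square_integrable_divide square_integrable_diff)
      (auto simp: has_ms_derivative_iff)
  moreover have "(F (x + t *\<^sub>R e) \<omega> - F x \<omega>) / t - (F' (flip x + t *\<^sub>R flip e) \<omega> - F' (flip x) \<omega>) / t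
      = (F (x + t *\<^sub>R e) \<omega> - F' (flip (x + t *\<^sub>R e)) \<omega> - (F x \<omega> - F' (flip x) \<omega>)) / t" for t \<omega>
    unfolding flip by (simp add: diff_divide_distrib)
  ultimately show ?thesis using sq by (auto simp: has_ms_derivative_iff)
qed

text \<open>
  Once the mean-square derivative exists, an ordinary derivative of an explicit covariance
  identifies its inner products, because these pass to the limit of the difference quotients.
\<close>
lemma has_ms_derivative_inner:
  assumes X: "has_ms_derivative M F e x X" and Y: "square_integrable M Y"
    and D: "((\<lambda>t. L2_inner M (F (x + t *\<^sub>R e)) Y) has_real_derivative D) (at 0)"
  shows "L2_inner M X Y = D"
proof -
  note sq = has_ms_derivative_square_integrable[OF X]
  have "((\<lambda>t. L2_inner M (\<lambda>\<omega>. (F (x + t *\<^sub>R e) \<omega> - F x \<omega>) / t) Y) \<longlongrightarrow> L2_inner M X Y) (at 0)"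
    using X Y sq by (intro L2_tendsto_inner_left always_eventually allI square_integrable_divide square_integrable_diff)
      (auto simp: has_ms_derivative_iff)
  then have "((\<lambda>t. L2_inner M (F (x + t *\<^sub>R e)) Y) has_real_derivative L2_inner M X Y) (at 0)"
    using sq Y by (simp add: has_field_derivative_iff L2_inner_divide_left L2_inner_diff_left)
  then show ?thesis using D by (rule DERIV_unique)
qed

lemma (in prob_space) stationary_has_ms_derivative:
  assumes sq: "\<And>p. square_integrable M (F p)"
    and cov: "\<And>p q. L2_inner M (F p) (F q) = k (p - q)"
    and Peano: "((\<lambda>r. (k (r *\<^sub>R e) - k 0) / r\<^sup>2) \<longlongrightarrow> l) (at 0)"
  shows "has_ms_derivative M F e x (ms_deriv M e F x)"
proof -
  have "\<exists>X. square_integrable M X \<and>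
      L2_tendsto M (\<lambda>t \<omega>. (F (x + t *\<^sub>R e) \<omega> - F (x + 0 *\<^sub>R e) \<omega>) / t) X (at 0)"
  proof (rule stationary_L2_differentiable)
    show "L2_inner M (F (x + s *\<^sub>R e)) (F (x + t *\<^sub>R e)) = k ((s - t) *\<^sub>R e)" for s t
      by (simp add: cov scaleR_diff_left)
  qed (use sq Peano in auto)
  then obtain X where "has_ms_derivative M F e x X" using sq by (auto simp: has_ms_derivative_iff)
  then show ?thesis by (rule ms_deriv_works)
qed

section \<open>Derivatives of an isotropic field and their covariances\<close>

text \<open>
  A one-sided derivative at 0 suffices because the argument is a multiple of a square; it turns into
  a two-sided second-order expansion, the form required of a stationary covariance.
\<close>
lemma Peano_square:
  assumes f: "(f has_real_derivative D) (at 0 within {0..})" and c: "0 \<le> c"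
  shows "((\<lambda>r. (f (c * r\<^sup>2) - f 0) / r\<^sup>2) \<longlongrightarrow> c * D) (at 0)"
proof (cases "c = 0")
  case False
  have "((\<lambda>y. (f y - f 0) / y) \<longlongrightarrow> D) (at 0 within {0..})"
    using f by (simp add: has_field_derivative_iff)
  moreover have "filterlim (\<lambda>r. c * r\<^sup>2) (at 0 within {0..}) (at 0)"
    unfolding filterlim_at
  proof
    show "\<forall>\<^sub>F r in at 0. c * r\<^sup>2 \<in> {0..} \<and> c * r\<^sup>2 \<noteq> 0"
      using c False by (auto simp: eventually_at intro!: exI[of _ 1])
    have "((\<lambda>r. c * r\<^sup>2) \<longlongrightarrow> c * 0\<^sup>2) (at 0)" by (intro tendsto_intros)
    then show "((\<lambda>r. c * r\<^sup>2) \<longlongrightarrow> 0) (at 0)" by simp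
  qed
  ultimately have "((\<lambda>r. (f (c * r\<^sup>2) - f 0) / (c * r\<^sup>2)) \<longlongrightarrow> D) (at 0)"
    by (rule filterlim_compose)
  from tendsto_mult_left[OF this, of c] show ?thesis using False by simp
qed simp

locale smooth_isotropic_field = prob_space M for M :: "'w measure" +
  fixes u :: "'a::real_inner \<Rightarrow> 'w \<Rightarrow> real" and h h' h'' :: "real \<Rightarrow> real"
  assumes u_square_integrable: "square_integrable M (u p)"
    and u_mean: "expectation (u p) = 0"
    and u_cov: "L2_inner M (u p) (u q) = h ((norm (p - q))\<^sup>2)"
    and h': "t \<ge> 0 \<Longrightarrow> (h has_real_derivative h' t) (at t within {0..})"
    and h'': "t \<ge> 0 \<Longrightarrow> (h' has_real_derivative h'' t) (at t within {0..})"
    and h''_continuous: "continuous_on {0..} h''"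
begin

lemma radial_derivative:
  assumes "\<And>t. t \<ge> 0 \<Longrightarrow> (f has_real_derivative f' t) (at t within {0..})"
  shows "((\<lambda>t. f ((norm (r + t *\<^sub>R a))\<^sup>2)) has_real_derivative 2 * f' ((norm r)\<^sup>2) * (r \<bullet> a)) (at 0)"
proof -
  let ?g = "\<lambda>t. (norm (r + t *\<^sub>R a))\<^sup>2"
  have "?g = (\<lambda>t. (norm r)\<^sup>2 + 2 * t * (r \<bullet> a) + t\<^sup>2 * (norm a)\<^sup>2)"
    by (simp add: power2_norm_eq_inner inner_add_left inner_add_right inner_commute[of a r] fun_eq_iff)
      (simp add: power2_eq_square algebra_simps)
  moreover have "((\<lambda>t. (norm r)\<^sup>2 + 2 * t * (r \<bullet> a) + t\<^sup>2 * (norm a)\<^sup>2) has_real_derivative 2 * (r \<bullet> a)) (at 0)"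
    by (auto intro!: derivative_eq_intros)
  ultimately have g: "(?g has_real_derivative 2 * (r \<bullet> a)) (at 0)" by simp
  have "(f has_real_derivative f' (?g 0)) (at (?g 0) within ?g ` UNIV)"
    by (rule has_field_derivative_subset[OF assms]) auto
  from DERIV_image_chain[OF this g] show ?thesis by (simp add: o_def mult.commute mult.left_commute mult.assoc)
qed

text \<open>
  Minus the second derivative of \<open>h(\<parallel>r\<parallel>\<^sup>2)\<close> along a and b, which is the covariance of the
  derivatives of u along a and b at two points with difference r.
\<close>
definition deriv_cov :: "'a \<Rightarrow> 'a \<Rightarrow> 'a \<Rightarrow> real" where
  "deriv_cov a b r = - 2 * h' ((norm r)\<^sup>2) * (a \<bullet> b) - 4 * h'' ((norm r)\<^sup>2) * (r \<bullet> a) * (r \<bullet> b)"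

lemma ms_deriv1: "has_ms_derivative M u a p (ms_deriv M a u p)"
proof (rule stationary_has_ms_derivative[where k = "\<lambda>r. h ((norm r)\<^sup>2)"])
  show "((\<lambda>r. (h ((norm (r *\<^sub>R a))\<^sup>2) - h ((norm (0::'a))\<^sup>2)) / r\<^sup>2) \<longlongrightarrow> (norm a)\<^sup>2 * h' 0) (at 0)"
    using Peano_square[OF h'[of 0], of "(norm a)\<^sup>2"] by (simp add: power_mult_distrib mult.commute)
qed (rule u_square_integrable u_cov)+

lemma ms_deriv1_square_integrable: "square_integrable M (ms_deriv M a u p)"
  by (rule has_ms_derivative_square_integrable(2)[OF ms_deriv1])

lemma cov_u_deriv1: "L2_inner M (ms_deriv M a u p) (u q) = 2 * h' ((norm (p - q))\<^sup>2) * ((p - q) \<bullet> a)"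
proof (rule has_ms_derivative_inner[OF ms_deriv1 u_square_integrable])
  have *: "p + t *\<^sub>R a - q = (p - q) + t *\<^sub>R a" for t by simp
  show "((\<lambda>t. L2_inner M (u (p + t *\<^sub>R a)) (u q)) has_real_derivative
      2 * h' ((norm (p - q))\<^sup>2) * ((p - q) \<bullet> a)) (at 0)"
    unfolding u_cov * by (rule radial_derivative[OF h'])
qed

text \<open>
  One derivative is moved into the field at a time, so that at each stage only a function of one
  real variable is differentiated.
\<close>
lemma cov_deriv1: "L2_inner M (ms_deriv M a u p) (ms_deriv M b u q) = deriv_cov a b (p - q)"
proof -
  let ?r = "p - q"
  have "L2_inner M (ms_deriv M b u q) (ms_deriv M a u p) = deriv_cov a b ?r"
  proof (rule has_ms_derivative_inner[OF ms_deriv1 ms_deriv1_square_integrable])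
    have *: "p - (q + t *\<^sub>R b) = ?r + t *\<^sub>R (- b)" for t by simp
    have "((\<lambda>t. h' ((norm (?r + t *\<^sub>R (- b)))\<^sup>2)) has_real_derivative
        2 * h'' ((norm ?r)\<^sup>2) * (?r \<bullet> (- b))) (at 0)"
      by (rule radial_derivative[OF h''])
    moreover have "((\<lambda>t. (?r + t *\<^sub>R (- b)) \<bullet> a) has_real_derivative (- (b \<bullet> a))) (at 0)"
      unfolding inner_add_left inner_scaleR_left by (auto intro!: derivative_eq_intros)
    ultimately have "((\<lambda>t. 2 * (h' ((norm (?r + t *\<^sub>R (- b)))\<^sup>2) * ((?r + t *\<^sub>R (- b)) \<bullet> a))) has_real_derivative
        2 * (2 * h'' ((norm ?r)\<^sup>2) * (?r \<bullet> (- b)) * ((?r + 0 *\<^sub>R (- b)) \<bullet> a)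
          + (- (b \<bullet> a)) * h' ((norm (?r + 0 *\<^sub>R (- b)))\<^sup>2))) (at 0)"
      by (intro DERIV_cmult DERIV_mult)
    then show "((\<lambda>t. L2_inner M (u (q + t *\<^sub>R b)) (ms_deriv M a u p)) has_real_derivative deriv_cov a b ?r) (at 0)"
      unfolding L2_inner_commute[of M "u _"] cov_u_deriv1 *
      by (simp add: deriv_cov_def inner_commute[of b a] mult.assoc) (simp add: algebra_simps)
  qed
  then show ?thesis by (simp add: L2_inner_commute)
qed

text \<open>
  The term of \<open>deriv_cov\<close> with h' contributes its first-order change. The term with h'' carries the
  factor \<open>r\<^sup>2\<close>, so that only the limit of h'' at 0 enters and its rate of convergence is irrelevant.
\<close>
lemma deriv_cov_Peano:
  "((\<lambda>r. (deriv_cov a c (r *\<^sub>R b) - deriv_cov a c 0) / r\<^sup>2) \<longlongrightarrow>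
     - 2 * h'' 0 * (b \<bullet> b) * (a \<bullet> c) - 4 * h'' 0 * (b \<bullet> a) * (b \<bullet> c)) (at 0)"
proof (rule Lim_transform_eventually)
  have P: "((\<lambda>r. (h' ((norm b)\<^sup>2 * r\<^sup>2) - h' 0) / r\<^sup>2) \<longlongrightarrow> (norm b)\<^sup>2 * h'' 0) (at 0)"
    by (rule Peano_square[OF h'']) simp_all
  have Q: "((\<lambda>r. h'' ((norm b)\<^sup>2 * r\<^sup>2)) \<longlongrightarrow> h'' ((norm b)\<^sup>2 * 0\<^sup>2)) (at 0)"
    by (rule continuous_on_tendsto_compose[OF h''_continuous]) (auto intro!: tendsto_eq_intros)
  have "((\<lambda>r. - 2 * ((h' ((norm b)\<^sup>2 * r\<^sup>2) - h' 0) / r\<^sup>2) * (a \<bullet> c)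
      - 4 * h'' ((norm b)\<^sup>2 * r\<^sup>2) * (b \<bullet> a) * (b \<bullet> c)) \<longlongrightarrow>
      - 2 * ((norm b)\<^sup>2 * h'' 0) * (a \<bullet> c) - 4 * h'' ((norm b)\<^sup>2 * 0\<^sup>2) * (b \<bullet> a) * (b \<bullet> c)) (at 0)"
    by (intro P Q tendsto_diff tendsto_mult tendsto_const)
  then show "((\<lambda>r. - 2 * ((h' ((norm b)\<^sup>2 * r\<^sup>2) - h' 0) / r\<^sup>2) * (a \<bullet> c)
      - 4 * h'' ((norm b)\<^sup>2 * r\<^sup>2) * (b \<bullet> a) * (b \<bullet> c)) \<longlongrightarrow>
      - 2 * h'' 0 * (b \<bullet> b) * (a \<bullet> c) - 4 * h'' 0 * (b \<bullet> a) * (b \<bullet> c)) (at 0)"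
    by (simp add: power2_norm_eq_inner mult.commute mult.left_commute)
  have "- 2 * ((h' ((norm b)\<^sup>2 * r\<^sup>2) - h' 0) / r\<^sup>2) * (a \<bullet> c)
      - 4 * h'' ((norm b)\<^sup>2 * r\<^sup>2) * (b \<bullet> a) * (b \<bullet> c)
      = (deriv_cov a c (r *\<^sub>R b) - deriv_cov a c 0) / r\<^sup>2" if "r \<noteq> 0" for r
  proof -
    have "(norm (r *\<^sub>R b))\<^sup>2 = (norm b)\<^sup>2 * r\<^sup>2" by (simp add: power_mult_distrib)
    then show ?thesis using that unfolding deriv_cov_def by (simp add: diff_divide_distrib algebra_simps) (simp add: power2_eq_square add_divide_distrib)
  qed
  then show "\<forall>\<^sub>F r in at 0. - 2 * ((h' ((norm b)\<^sup>2 * r\<^sup>2) - h' 0) / r\<^sup>2) * (a \<bullet> c)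
      - 4 * h'' ((norm b)\<^sup>2 * r\<^sup>2) * (b \<bullet> a) * (b \<bullet> c)
      = (deriv_cov a c (r *\<^sub>R b) - deriv_cov a c 0) / r\<^sup>2"
    by (auto simp: eventually_at intro!: exI[of _ 1])
qed

lemma ms_deriv2: "has_ms_derivative M (ms_deriv M a u) b p (ms_deriv M b (ms_deriv M a u) p)"
  by (rule stationary_has_ms_derivative[OF ms_deriv1_square_integrable cov_deriv1 deriv_cov_Peano])

lemma ms_deriv2_square_integrable: "square_integrable M (ms_deriv M b (ms_deriv M a u) p)"
  by (rule has_ms_derivative_square_integrable(2)[OF ms_deriv2])

text \<open>The covariance of first derivatives expands around the origin without a linear term.\<close>
lemma cov_deriv2_deriv1: "L2_inner M (ms_deriv M b (ms_deriv M a u) p) (ms_deriv M c u p) = 0"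
proof (rule has_ms_derivative_inner[OF ms_deriv2 ms_deriv1_square_integrable])
  have "((\<lambda>r. r * ((deriv_cov a c (r *\<^sub>R b) - deriv_cov a c 0) / r\<^sup>2)) \<longlongrightarrow> 0) (at 0)"
    using tendsto_mult[OF tendsto_ident_at deriv_cov_Peano[of a c b]] by simp
  then have "((\<lambda>r. (deriv_cov a c (r *\<^sub>R b) - deriv_cov a c 0) / r) \<longlongrightarrow> 0) (at 0)"
    by (rule Lim_transform_eventually) (auto simp: eventually_at power2_eq_square intro!: exI[of _ 1])
  then show "((\<lambda>t. L2_inner M (ms_deriv M a u (p + t *\<^sub>R b)) (ms_deriv M c u p)) has_real_derivative 0) (at 0)"
    by (simp add: has_field_derivative_iff cov_deriv1)
qed

text \<open>
  Both second derivatives are approximated by difference quotients with one common step s. By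
  stationarity their covariance only involves the three displacements \<open>s (b - d)\<close>, \<open>s b\<close> and
  \<open>- s d\<close> along fixed lines through the origin, where \<open>deriv_cov_Peano\<close> applies; the limit is
  the polar form of the quadratic form in that lemma.
\<close>
lemma cov_deriv2:
  "L2_inner M (ms_deriv M b (ms_deriv M a u) p) (ms_deriv M d (ms_deriv M c u) p)
    = 4 * h'' 0 * ((a \<bullet> b) * (c \<bullet> d) + (a \<bullet> c) * (b \<bullet> d) + (a \<bullet> d) * (b \<bullet> c))"
proof -
  let ?A = "\<lambda>s \<omega>. (ms_deriv M a u (p + s *\<^sub>R b) \<omega> - ms_deriv M a u p \<omega>) / s"
  let ?B = "\<lambda>s \<omega>. (ms_deriv M c u (p + s *\<^sub>R d) \<omega> - ms_deriv M c u p \<omega>) / s"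
  let ?P = "\<lambda>s e. (deriv_cov a c (s *\<^sub>R e) - deriv_cov a c 0) / s\<^sup>2"
  note sq = ms_deriv1_square_integrable
  have AB: "L2_inner M (?A s) (?B s) = ?P s (b - d) - ?P s b - ?P s (- d)" for s
    using sq by (simp add: L2_inner_divide_left L2_inner_divide_right L2_inner_diff_left L2_inner_diff_right
        square_integrable_diff cov_deriv1 scaleR_diff_right)
      (simp add: power2_eq_square diff_divide_distrib add_divide_distrib)
  have "((\<lambda>s. L2_inner M (?A s) (?B s)) \<longlongrightarrow>
      L2_inner M (ms_deriv M b (ms_deriv M a u) p) (ms_deriv M d (ms_deriv M c u) p)) (at 0)"
    using ms_deriv2[of a b p] ms_deriv2[of c d p]
    by (intro L2_tendsto_inner square_integrable_divide square_integrable_diff sq ms_deriv2_square_integrable)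
      (auto simp: has_ms_derivative_iff)
  moreover have "((\<lambda>s. L2_inner M (?A s) (?B s)) \<longlongrightarrow>
      4 * h'' 0 * ((a \<bullet> b) * (c \<bullet> d) + (a \<bullet> c) * (b \<bullet> d) + (a \<bullet> d) * (b \<bullet> c))) (at 0)"
    unfolding AB
    by (rule tendsto_eq_rhs[OF tendsto_diff[OF tendsto_diff[OF deriv_cov_Peano deriv_cov_Peano] deriv_cov_Peano]])
      (simp add: inner_simps inner_commute algebra_simps)
  ultimately show ?thesis by (rule LIM_unique)
qed

lemma mean_deriv1: "L2_inner M (ms_deriv M a u p) (\<lambda>_. 1) = 0"
  by (rule has_ms_derivative_inner[OF ms_deriv1 square_integrable_const]) (simp add: L2_inner_def u_mean)

lemma mean_deriv2: "L2_inner M (ms_deriv M b (ms_deriv M a u) p) (\<lambda>_. 1) = 0"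
  by (rule has_ms_derivative_inner[OF ms_deriv2 square_integrable_const]) (simp add: mean_deriv1)

end

section \<open>Derivatives of the block field on the diagonal\<close>

lemma inner_flip_flip: "flip a \<bullet> flip b = a \<bullet> b" and inner_flip_left: "flip a \<bullet> b = a \<bullet> flip b"
  for a b :: "'d::finite pt"
  by (simp_all add: inner_prod_def)

locale block_isotropic_field = smooth_isotropic_field M u h h' h''
  for M :: "'w measure" and u :: "'d::finite pt \<Rightarrow> 'w \<Rightarrow> real" and h h' h'' +
  fixes z :: "'d pt"
  assumes flip_z: "flip z = z"
begin

abbreviation block_d1 :: "'d pt \<Rightarrow> 'd pt \<Rightarrow> 'w \<Rightarrow> real" where
  "block_d1 a \<equiv> ms_deriv M a (block_field u)"

abbreviation block_d2 :: "'d pt \<Rightarrow> 'd pt \<Rightarrow> 'd pt \<Rightarrow> 'w \<Rightarrow> real" where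
  "block_d2 a b \<equiv> ms_deriv M b (block_d1 a)"

lemma has_block_deriv1: "has_ms_derivative M (block_field u) a p
    (\<lambda>\<omega>. ms_deriv M a u p \<omega> - ms_deriv M (flip a) u (flip p) \<omega>)"
  unfolding block_field_def by (rule has_ms_derivative_diff_flip[OF ms_deriv1 ms_deriv1])

lemma block_deriv1_AE: "AE \<omega> in M. block_d1 a p \<omega> = ms_deriv M a u p \<omega> - ms_deriv M (flip a) u (flip p) \<omega>"
  by (rule has_ms_derivative_unique_AE[OF ms_deriv_works has_block_deriv1]) (rule has_block_deriv1)

lemma block_deriv1_square_integrable: "square_integrable M (block_d1 a p)"
  by (rule has_ms_derivative_square_integrable[OF ms_deriv_works[OF has_block_deriv1]])

text \<open>
  The first derivatives of the block field are selected versions, equal to differences of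
  derivatives of u only almost surely at each point; this does not affect mean-square derivatives.
\<close>
lemma has_block_deriv2: "has_ms_derivative M (block_d1 a) b p
    (\<lambda>\<omega>. ms_deriv M b (ms_deriv M a u) p \<omega> - ms_deriv M (flip b) (ms_deriv M (flip a) u) (flip p) \<omega>)"
proof (rule has_ms_derivative_cong_AE[OF has_ms_derivative_diff_flip[OF ms_deriv2 ms_deriv2]])
  show "AE \<omega> in M. ms_deriv M a u y \<omega> - ms_deriv M (flip a) u (flip y) \<omega> = block_d1 a y \<omega>" for y
    using block_deriv1_AE[of a y] by eventually_elim simp
qed (rule block_deriv1_square_integrable)

lemma block_deriv2_AE: "AE \<omega> in M. block_d2 a b p \<omega>
    = ms_deriv M b (ms_deriv M a u) p \<omega> - ms_deriv M (flip b) (ms_deriv M (flip a) u) (flip p) \<omega>"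
  by (rule has_ms_derivative_unique_AE[OF ms_deriv_works has_block_deriv2]) (rule has_block_deriv2)

lemma block_deriv2_square_integrable: "square_integrable M (block_d2 a b p)"
  by (rule has_ms_derivative_square_integrable[OF ms_deriv_works[OF has_block_deriv2]])

lemmas d_square_integrable = ms_deriv1_square_integrable ms_deriv2_square_integrable
  block_deriv1_square_integrable block_deriv2_square_integrable

lemma L2_inner_block_cong:
  assumes "AE \<omega> in M. X \<omega> = X1 \<omega> - X2 \<omega>" "AE \<omega> in M. Y \<omega> = Y1 \<omega> - Y2 \<omega>"
    and "square_integrable M X" "square_integrable M X1" "square_integrable M X2"
    and "square_integrable M Y" "square_integrable M Y1" "square_integrable M Y2"
  shows "L2_inner M X Y = L2_inner M X1 Y1 - L2_inner M X1 Y2 - L2_inner M X2 Y1 + L2_inner M X2 Y2"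
proof -
  have "L2_inner M X Y = L2_inner M (\<lambda>\<omega>. X1 \<omega> - X2 \<omega>) (\<lambda>\<omega>. Y1 \<omega> - Y2 \<omega>)"
    using assms by (intro L2_inner_cong_AE) (auto simp: square_integrable_def)
  then show ?thesis
    using assms by (simp add: L2_inner_diff_left L2_inner_diff_right square_integrable_diff)
qed

lemma cov_block_deriv1:
  "L2_inner M (block_d1 a z) (block_d1 c z) = - 4 * h' 0 * (a \<bullet> c - a \<bullet> flip c)"
  unfolding L2_inner_block_cong[OF block_deriv1_AE block_deriv1_AE d_square_integrable(3,1,1) d_square_integrable(3,1,1)]
  by (simp add: flip_z cov_deriv1 deriv_cov_def inner_flip_flip inner_flip_left algebra_simps)

lemma cov_block_deriv2_deriv1: "L2_inner M (block_d2 a b z) (block_d1 c z) = 0"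
  unfolding L2_inner_block_cong[OF block_deriv2_AE block_deriv1_AE d_square_integrable(4,2,2) d_square_integrable(3,1,1)]
  by (simp add: flip_z cov_deriv2_deriv1)

text \<open>
  The products of \<open>a \<bullet> b\<close> and \<open>c \<bullet> d\<close> cancel, since both factors are invariant under flipping
  their two arguments.
\<close>
lemma cov_block_deriv2:
  "L2_inner M (block_d2 a b z) (block_d2 c d z) = 8 * h'' 0 *
     ((a \<bullet> c) * (b \<bullet> d) + (a \<bullet> d) * (b \<bullet> c)
      - (a \<bullet> flip c) * (b \<bullet> flip d) - (a \<bullet> flip d) * (b \<bullet> flip c))"
  unfolding L2_inner_block_cong[OF block_deriv2_AE block_deriv2_AE d_square_integrable(4,2,2) d_square_integrable(4,2,2)]
  by (simp add: flip_z cov_deriv2 inner_flip_flip inner_flip_left) (simp add: algebra_simps)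

lemma mean_block_deriv1: "L2_inner M (block_d1 a z) (\<lambda>_. 1) = 0"
  using L2_inner_block_cong[OF block_deriv1_AE[of a z], of "\<lambda>_. 1" "\<lambda>_. 1" "\<lambda>_. 0"] d_square_integrable
  by (simp add: flip_z mean_deriv1 square_integrable_const) (simp add: L2_inner_def)

lemma mean_block_deriv2: "L2_inner M (block_d2 a b z) (\<lambda>_. 1) = 0"
  using L2_inner_block_cong[OF block_deriv2_AE[of b a z], of "\<lambda>_. 1" "\<lambda>_. 1" "\<lambda>_. 0"] d_square_integrable
  by (simp add: flip_z mean_deriv2 square_integrable_const) (simp add: L2_inner_def)

end

section \<open>The covariance of the Taylor polynomial\<close>

lemma linear_axis_sum:
  fixes L :: "real^'d \<Rightarrow> real"
  assumes "linear L"
  shows "(\<Sum>i\<in>UNIV. v $ i * L (axis i 1)) = L v"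
proof -
  have "L v = L (\<Sum>i\<in>UNIV. (v $ i) *\<^sub>R axis i 1)"
    using basis_expansion[of v] by (simp add: scalar_mult_eq_scaleR)
  then show ?thesis using assms by (simp add: linear_sum linear_cmul)
qed

lemma bilinear_axis_sum:
  fixes B :: "real^'d::finite \<Rightarrow> real^'d \<Rightarrow> real"
  assumes "bilinear B"
  shows "(\<Sum>i\<in>UNIV. \<Sum>j\<in>UNIV. v $ i * (w $ j * B (axis i 1) (axis j 1))) = B v w"
proof -
  have "(\<Sum>i\<in>UNIV. v $ i * (\<Sum>j\<in>UNIV. w $ j * B (axis i 1) (axis j 1))) = (\<Sum>i\<in>UNIV. v $ i * B (axis i 1) w)"
    using assms by (intro sum.cong refl arg_cong2[where f = "(*)"] linear_axis_sum) (simp add: bilinear_def)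
  also have "\<dots> = B v w"
    using assms by (intro linear_axis_sum[of "\<lambda>v. B v w"]) (simp add: bilinear_def)
  finally show ?thesis by (simp add: sum_distrib_left)
qed

context block_isotropic_field
begin

text \<open>
  The shape of the skew-symmetric Taylor polynomial with the gradient replaced by a linear form and
  the Hessian by a bilinear form. The inner product of the Taylor polynomial with a random variable
  has this shape whenever those of the derivatives depend linearly on the directions; the covariance
  of the Taylor polynomial is obtained by using this once in each argument.
\<close>
definition taylor_of :: "('d pt \<Rightarrow> real) \<Rightarrow> ('d pt \<Rightarrow> 'd pt \<Rightarrow> real) \<Rightarrow> real^'d \<Rightarrow> real^'d \<Rightarrow> real" where
  "taylor_of L B v w = L (v - w, 0) + (1/2) * (B (v, 0) (v, 0) - B (w, 0) (w, 0)) + B (v, 0) (0, w)"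

lemma skew_taylor2_sum:
  assumes z: "z = (zs, zs)"
  shows "skew_taylor2 M (block_field u) zs x = (\<lambda>\<omega>.
    (\<Sum>i\<in>UNIV. ((fst x - zs) - (snd x - zs)) $ i * block_d1 (dir1 i) z \<omega>)
    + (1/2) * ((\<Sum>i\<in>UNIV. \<Sum>j\<in>UNIV. (fst x - zs) $ i * ((fst x - zs) $ j * block_d2 (dir1 j) (dir1 i) z \<omega>))
      - (\<Sum>i\<in>UNIV. \<Sum>j\<in>UNIV. (snd x - zs) $ i * ((snd x - zs) $ j * block_d2 (dir1 j) (dir1 i) z \<omega>)))
    + (\<Sum>i\<in>UNIV. \<Sum>j\<in>UNIV. (fst x - zs) $ i * ((snd x - zs) $ j * block_d2 (dir2 j) (dir1 i) z \<omega>)))"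
  unfolding skew_taylor2_def Let_def z taylor_g_def taylor_H11_def taylor_H12_def
  by (simp add: inner_vec_def matrix_vector_mult_def sum_distrib_left mult.commute mult.left_commute)

lemma skew_taylor2_square_integrable:
  assumes z: "z = (zs, zs)"
  shows "square_integrable M (skew_taylor2 M (block_field u) zs x)"
  unfolding skew_taylor2_sum[OF z]
  by (intro square_integrable_add square_integrable_diff square_integrable_sum square_integrable_cmult d_square_integrable)

text \<open>
  The arguments of B are swapped because in the Hessian entry with indices i and j the derivative
  in direction j is taken first.
\<close>
lemma L2_inner_skew_taylor2:
  assumes z: "z = (zs, zs)" and Y: "square_integrable M Y"
    and L: "linear L" "\<And>a. L2_inner M (block_d1 a z) Y = L a"
    and B: "bilinear B" "\<And>a b. L2_inner M (block_d2 a b z) Y = B b a"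
  shows "L2_inner M (skew_taylor2 M (block_field u) zs x) Y = taylor_of L B (fst x - zs) (snd x - zs)"
proof -
  have d_square_integrable': "square_integrable M (\<lambda>\<omega>. \<Sum>i\<in>I. X i \<omega>)" if "\<And>i. square_integrable M (X i)" for X :: "'d \<Rightarrow> _" and I
    using that by auto
  have lin: "linear (\<lambda>v. (v, 0::real^'d))" "linear (\<lambda>v. (0::real^'d, v))"
    by (auto intro!: linearI)
  have L1: "(\<Sum>i\<in>UNIV. v $ i * L (dir1 i)) = L (v, 0)" for v
    using linear_axis_sum[OF linear_compose[OF lin(1) L(1)]] by simp
  have comp: "bilinear (\<lambda>v w. B (S v) (T w))" if "linear S" "linear T" for S T :: "real^'d \<Rightarrow> 'd pt"
    using B(1) linear_compose[OF that(1), unfolded o_def] linear_compose[OF that(2), unfolded o_def]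
    unfolding bilinear_def by blast
  have B11: "(\<Sum>i\<in>UNIV. \<Sum>j\<in>UNIV. v $ i * (w $ j * B (dir1 i) (dir1 j))) = B (v, 0) (w, 0)" for v w
    using bilinear_axis_sum[OF comp[OF lin(1) lin(1)]] .
  have B12: "(\<Sum>i\<in>UNIV. \<Sum>j\<in>UNIV. v $ i * (w $ j * B (dir1 i) (dir2 j))) = B (v, 0) (0, w)" for v w
    using bilinear_axis_sum[OF comp[OF lin(1) lin(2)]] .
  show ?thesis
    unfolding skew_taylor2_sum[OF z] taylor_of_def
    by (simp only: L1 B11 B12 L2_inner_add_left L2_inner_diff_left L2_inner_cmult_left L2_inner_sum_left L(2) B(2) Y
        d_square_integrable d_square_integrable' square_integrable_cmult square_integrable_add square_integrable_diff)
qed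

lemma taylor_mean:
  assumes z: "z = (zs, zs)"
  shows "expectation (skew_taylor2 M (block_field u) zs x) = 0"
proof -
  have "L2_inner M (skew_taylor2 M (block_field u) zs x) (\<lambda>_. 1)
      = taylor_of (\<lambda>_. 0) (\<lambda>_ _. 0) (fst x - zs) (snd x - zs)"
    by (rule L2_inner_skew_taylor2[OF z])
      (auto simp: bilinear_def mean_block_deriv1 mean_block_deriv2 intro!: linearI)
  then show ?thesis by (simp add: L2_inner_def taylor_of_def)
qed

lemma taylor_cov:
  assumes z: "z = (zs, zs)"
  shows "L2_inner M (skew_taylor2 M (block_field u) zs x) (skew_taylor2 M (block_field u) zs y) =
      - 4 * h' 0 * ((x - z) \<bullet> (y - z) - (x - z) \<bullet> flip (y - z))
      + 4 * h'' 0 * (((x - z) \<bullet> (y - z))\<^sup>2 - ((x - z) \<bullet> flip (y - z))\<^sup>2)"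
proof -
  let ?T = "skew_taylor2 M (block_field u) zs"
  let ?L = "\<lambda>c a. - 4 * h' 0 * (a \<bullet> c - a \<bullet> flip c)"
  let ?B = "\<lambda>c d b a. 8 * h'' 0 * ((a \<bullet> c) * (b \<bullet> d) + (a \<bullet> d) * (b \<bullet> c)
      - (a \<bullet> flip c) * (b \<bullet> flip d) - (a \<bullet> flip d) * (b \<bullet> flip c))"
  define v w where "v = fst y - zs" and "w = snd y - zs"
  have linL: "linear (?L c)" for c :: "'d pt"
    by (rule linearI) (simp_all add: inner_simps algebra_simps)
  have bilB: "bilinear (?B c d)" for c d :: "'d pt"
    unfolding bilinear_def by (intro conjI allI linearI) (simp_all add: inner_simps algebra_simps)
  have T1: "L2_inner M (?T y) (block_d1 c z) = taylor_of (?L c) (\<lambda>_ _. 0) v w" for c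
    unfolding v_def w_def
    by (rule L2_inner_skew_taylor2[OF z d_square_integrable(3) linL cov_block_deriv1])
      (auto simp: cov_block_deriv2_deriv1 bilinear_def intro!: linearI)
  have T2: "L2_inner M (?T y) (block_d2 c d z) = taylor_of (\<lambda>_. 0) (?B c d) v w" for c d
    unfolding v_def w_def
    by (rule L2_inner_skew_taylor2[OF z d_square_integrable(4) _ _ bilB cov_block_deriv2])
      (auto simp: cov_block_deriv2_deriv1 L2_inner_commute[of M "block_d1 _ _"] intro!: linearI)
  have "L2_inner M (?T x) (?T y) = taylor_of (\<lambda>c. taylor_of (?L c) (\<lambda>_ _. 0) v w)
      (\<lambda>d c. taylor_of (\<lambda>_. 0) (?B c d) v w) (fst x - zs) (snd x - zs)"
  proof (rule L2_inner_skew_taylor2[OF z skew_taylor2_square_integrable[OF z]])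
    show "linear (\<lambda>c. taylor_of (?L c) (\<lambda>_ _. 0) v w)"
      by (auto intro!: linearI simp: taylor_of_def inner_prod_def inner_simps algebra_simps)
    show "bilinear (\<lambda>d c. taylor_of (\<lambda>_. 0) (?B c d) v w)"
      unfolding bilinear_def
      by (auto intro!: linearI simp: taylor_of_def inner_prod_def inner_simps algebra_simps)
  qed (simp_all add: L2_inner_commute[of M "block_d1 _ _"] L2_inner_commute[of M "block_d2 _ _ _"] T1 T2)
  also have "\<dots> = - 4 * h' 0 * ((x - z) \<bullet> (y - z) - (x - z) \<bullet> flip (y - z))
      + 4 * h'' 0 * (((x - z) \<bullet> (y - z))\<^sup>2 - ((x - z) \<bullet> flip (y - z))\<^sup>2)"
  proof -
    define v' w' where "v' = fst x - zs" and "w' = snd x - zs"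
    have "x - z = (v', w')" "y - z = (v, w)" by (auto simp: z v_def w_def v'_def w'_def prod_eq_iff)
    then show ?thesis
      unfolding v'_def[symmetric] w'_def[symmetric]
      by (simp add: taylor_of_def inner_diff_left inner_diff_right inner_commute[of v v'] inner_commute[of v w']
          inner_commute[of w v'] inner_commute[of w w'] power2_eq_square)
        (simp add: field_simps)
  qed
  finally show ?thesis .
qed

end

theorem proposition24:
  fixes M :: "'w measure"
    and u :: "(real^'d::finite) \<times> (real^'d) \<Rightarrow> 'w \<Rightarrow> real"
    and h h' h'' :: "real \<Rightarrow> real"
    and zs :: "real^'d"
    and x y :: "(real^'d) \<times> (real^'d)"
  assumes "prob_space M"
    and "gaussian_field M u"
    and "\<And>p. integral\<^sup>L M (u p) = 0"
    and "\<And>p q. covariance_fun M u p q = h ((norm (p - q))\<^sup>2)"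
    and "times_cont_differentiable 4 (\<lambda>(p, q). covariance_fun M u p q)"
    and "\<And>t. t \<ge> 0 \<Longrightarrow> (h has_real_derivative h' t) (at t within {0..})"
    and "\<And>t. t \<ge> 0 \<Longrightarrow> (h' has_real_derivative h'' t) (at t within {0..})"
    and "continuous_on {0..} h''"
  shows "let z = (zs, zs); dx = x - z; dy = y - z in
    covariance_fun M (skew_taylor2 M (block_field u) zs) x y =
      - 4 * h' 0 * (dx \<bullet> dy - dx \<bullet> flip dy)
      + 4 * h'' 0 * ((dx \<bullet> dy)\<^sup>2 - (dx \<bullet> flip dy)\<^sup>2)"
proof -
  interpret prob_space M by fact
  have cov: "L2_inner M (u p) (u q) = h ((norm (p - q))\<^sup>2)" for p q
    using assms(4)[of p q] by (simp add: covariance_fun_def covariance_def L2_inner_def assms(3))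
  interpret block_isotropic_field M u h h' h'' "(zs, zs)"
    by unfold_locales (auto intro: gaussian_field_square_integrable assms cov)
  have "covariance_fun M (skew_taylor2 M (block_field u) zs) x y
      = L2_inner M (skew_taylor2 M (block_field u) zs x) (skew_taylor2 M (block_field u) zs y)"
    by (simp add: covariance_fun_def covariance_def L2_inner_def taylor_mean)
  then show ?thesis unfolding Let_def taylor_cov[OF refl] .
qed

end
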